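(* Consider the second-order prediction method PTFM2, described in the context, with parameter $r\in(0,1)$ and $\beta=\frac{r}{2+r}$. For $w=(v^{(0)},v)\in\mathcal F_p$ let $\mu^*(w)=\frac{(v^{(0)})^2}{v^{(0)}-\|v\|^2}$ (so that $\mu^*(w)\ge v^{(0)}$). Then for every iteration $k\ge0$ at which a predictor step is performed, $$\mu^*(w_{k+1})\le\frac{1}{1+\gamma_2}\,\mu^*(w_k),\qquad \gamma_2=\frac{\left(\frac r2\sqrt{1-\beta}\right)^{1/3}}{\bar n_r^{1/2}\left(1+\frac16\left(\frac{r}{2(1-\beta)}\right)^{1/3}\right)+\left(\frac r2\sqrt{1-\beta}\right)^{1/3}},$$ where $\bar n_r=\max\{\hat n_r,n_r\}$, $n_r=\frac{25}{6}+\frac{n}{1-\beta}$, $\hat n_r=\sqrt{\frac{16}{27}(n+1)+\frac12n_r^2}$.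
   Context: Let $A\in\mathbb{R}^{m\times n}$ (of full row rank), $b\in\mathbb{R}^m$, $c\in\mathbb{R}^n$ and $\mathcal F_0=\{u=(x,s,y): Ax=b,\ s+A^Ty=c,\ x>0,\ s>0\}$, assumed nonempty (the relative interior of the feasible set of the primal-dual pair $\min\{\langle c,x\rangle: Ax=b,\ x\ge0\}=\max\{\langle b,y\rangle: s+A^Ty=c,\ s\ge0\}$). Notation. Products, powers and square roots of vectors are componentwise; $\|\cdot\|$ is the Euclidean norm; $\check e\in\mathbb{R}^n$ is the vector of ones. Control variables: $w=(v^{(0)},v)\in\mathcal F_p=\{(v^{(0)},v)\in\mathbb{R}_+\times\mathbb{R}^n: v^{(0)}>\|v\|^2\}$, $\rho(w)=\frac{v^{(0)}-\|v\|^2}{n+1}$. For $z=(u,w)$, $u=(x,s,y)$, the residual $r(z)\in\mathbb{R}^{n+1}$ has components $r^{(0)}(z)=v^{(0)}-\langle s,x\rangle$, $r^{(i)}(z)=x^{(i)}s^{(i)}-(v^{(i)})^2$ for $1\le i\le n$; $\check r(z)\in\mathbb{R}^n$ consists of components $1,\dots,n$. Let $\mathcal F=\{(u,w): u\in\mathcal F_0, w\in\mathcal F_p, r(z)\ge0\}$; its interior is given by $r(z)>0$. On the interior, $F(z)=-\sum_{i=0}^n\ln r^{(i)}(z)$ and $\Psi(z)=F(z)+(n+1)\ln\rho(w)\ge0$ is the functional proximity measure. For $k=0,1,2$ let $\chi_k(z)=\Big[\sum_{i=0}^n\frac{(r^{(i)}(z)-\rho(w))^2}{[r^{(i)}(z)]^k[\rho(w)]^{2-k}}\Big]^{1/2}$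 and $\delta(z)=\chi_1^2(z)/\chi_2(z)$ ($\delta(z)=0$ if $\chi_2(z)=0$). For $u_k=(x_k,s_k,y_k)\in\mathcal F_0$ with $X_k=\mathrm{Diag}(x_k)$, $S_k=\mathrm{Diag}(s_k)$ and $d\in\mathbb{R}^n$, $\Delta_k(d)=(\Delta^x,\Delta^s,\Delta^y)$ is the unique solution of $X_k\Delta^s+S_k\Delta^x=d$, $A\Delta^x=0$, $\Delta^s+A^T\Delta^y=0$. Let $\omega_*(\tau)=-\tau-\ln(1-\tau)$, $0\le\tau<1$. Method PTFM2. Choose $r\in(0,1)$, $A_\psi=\omega_*(r)$, $\beta=\frac{r}{2+r}$, $u_0=(x_0,s_0,y_0)\in\mathcal F_0$. With $\sigma=\min_i x_0^{(i)}s_0^{(i)}$, set $w_0=(v_0^{(0)},v_0)$ where $v_0^{(0)}=\langle s_0,x_0\rangle+\sigma$, $v_0^{(i)}=\sqrt{x_0^{(i)}s_0^{(i)}-\sigma}$. At iteration $k\ge0$, with $z_k=(u_k,w_k)$, $w_k=(v_k^{(0)},v_k)$: Predictor step (performed if $\delta(z_k)\le\beta$): set $\tilde d_k=\frac{\|v_k\|^2}{n+1}\check e-v_k^2-x_ks_k$, $\tilde\Delta_k=\Delta_k(\tilde d_k)$; set $\widehat d_k=v_k^2-\frac{\|v_k\|^2}{n+1}\check e-\tilde\Delta_k^x\tilde\Delta_k^s$, $\widehat\Delta_k=\Delta_k(\widehat d_k)$; take $\alpha_k\in(0,1)$ a solution of $\Psi(u_k+\alpha\tilde\Delta_k+\alpha^2\widehat\Delta_k,(1-\alpha)w_k)=A_\psi$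 (with the point in the interior of $\mathcal F$), and set $u_{k+1}=u_k+\alpha_k\tilde\Delta_k+\alpha_k^2\widehat\Delta_k$, $w_{k+1}=(1-\alpha_k)w_k$. Corrector step (otherwise): set $d_k=\rho(w_k)\check e-\check r(z_k)$, $\Delta_k=\Delta_k(d_k)$, take $\alpha_k\ge0$ an approximate minimizer of $F(u_k+\alpha\Delta_k,w_k)$ over $\alpha\ge0$, and set $u_{k+1}=u_k+\alpha_k\Delta_k$, $w_{k+1}=w_k$. Stop if $v_k^{(0)}\le\epsilon$ and $\delta(z_k)\le\beta$. *)

theory Defs
  imports "HOL-Analysis.Analysis"
begin

text \<open>Products, powers and the constant \<open>1\<close> on \<^typ>\<open>real^'n\<close> are the componentwise library
  operations; sums and scalar multiples of tuples are also componentwise.\<close>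

type_synonym ('n, 'm) primal_dual = "(real^'n) \<times> (real^'n) \<times> (real^'m)"
type_synonym 'n control = "real \<times> (real^'n)"

definition strictly_feasible ::
    "real^'n^'m \<Rightarrow> real^'m \<Rightarrow> real^'n \<Rightarrow> ('n, 'm) primal_dual set" where
  "strictly_feasible A b c =
    {(x, s, y). A *v x = b \<and> s + transpose A *v y = c \<and> (\<forall>i. x $ i > 0) \<and> (\<forall>i. s $ i > 0)}"

definition control_set :: "'n::finite control set" where
  "control_set = {(v0, v). v0 \<ge> 0 \<and> v0 > (norm v)\<^sup>2}"

definition rho :: "'n::finite control \<Rightarrow> real" where
  "rho w = (case w of (v0, v) \<Rightarrow> (v0 - (norm v)\<^sup>2) / (real CARD('n) + 1))"

text \<open>Vectors with components \<open>0, \<dots>, n\<close> are indexed by \<^typ>\<open>'n option\<close>: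
  \<open>None\<close> plays the role of the index \<open>0\<close> and \<open>Some i\<close> that of the index \<open>i \<ge> 1\<close>.\<close>

definition resid ::
    "('n::finite, 'm::finite) primal_dual \<times> 'n control \<Rightarrow> real^('n option)" where
  "resid z = (case z of ((x, s, y), (v0, v)) \<Rightarrow>
    (\<chi> j. case j of None \<Rightarrow> v0 - s \<bullet> x | Some i \<Rightarrow> x $ i * s $ i - (v $ i)\<^sup>2))"

definition resid_tail ::
    "('n::finite, 'm::finite) primal_dual \<times> 'n control \<Rightarrow> real^'n" where
  "resid_tail z = (\<chi> i. resid z $ Some i)"

definition interior_set ::
    "real^'n^'m \<Rightarrow> real^'m \<Rightarrow> real^'n \<Rightarrow> (('n, 'm) primal_dual \<times> 'n control) set" where
  "interior_set A b c =
    {(u, w). u \<in> strictly_feasible A b c \<and> w \<in> control_set \<and> (\<forall>j. resid (u, w) $ j > 0)}"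

text \<open>The functions below are meaningful on the interior only, where all residuals and
  \<open>rho\<close> are positive.\<close>

definition barrier :: "('n::finite, 'm::finite) primal_dual \<times> 'n control \<Rightarrow> real" where
  "barrier z = - (\<Sum>j\<in>UNIV. ln (resid z $ j))"

definition proximity :: "('n::finite, 'm::finite) primal_dual \<times> 'n control \<Rightarrow> real" where
  "proximity z = barrier z + (real CARD('n) + 1) * ln (rho (snd z))"

text \<open>Only used for \<open>k \<le> 2\<close>, so that \<open>2 - k\<close> does not truncate.\<close>

definition chi_measure ::
    "nat \<Rightarrow> ('n::finite, 'm::finite) primal_dual \<times> 'n control \<Rightarrow> real" where
  "chi_measure k z = sqrt (\<Sum>j\<in>UNIV. (resid z $ j - rho (snd z))\<^sup>2
      / ((resid z $ j) ^ k * rho (snd z) ^ (2 - k)))"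

definition delta_measure ::
    "('n::finite, 'm::finite) primal_dual \<times> 'n control \<Rightarrow> real" where
  "delta_measure z =
    (if chi_measure 2 z = 0 then 0 else (chi_measure 1 z)\<^sup>2 / chi_measure 2 z)"

text \<open>The Newton system has exactly one solution if \<open>A\<close> has full row rank and \<open>x, s > 0\<close>.\<close>

definition newton_dir ::
    "real^'n^'m \<Rightarrow> ('n, 'm) primal_dual \<Rightarrow> real^'n \<Rightarrow> ('n, 'm) primal_dual" where
  "newton_dir A u d = (case u of (x, s, y) \<Rightarrow>
    (THE (dx, ds, dy). x * ds + s * dx = d \<and> A *v dx = 0 \<and> ds + transpose A *v dy = 0))"

definition omega_star :: "real \<Rightarrow> real" where
  "omega_star \<tau> = - \<tau> - ln (1 - \<tau>)"

definition beta_param :: "real \<Rightarrow> real" where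
  "beta_param r = r / (2 + r)"

definition initial_control :: "('n::finite, 'm::finite) primal_dual \<Rightarrow> 'n control" where
  "initial_control u = (case u of (x, s, y) \<Rightarrow>
    (let \<sigma> = Min (range (\<lambda>i. x $ i * s $ i))
     in (s \<bullet> x + \<sigma>, \<chi> i. sqrt (x $ i * s $ i - \<sigma>))))"

definition pred_dir1 ::
    "real^'n^'m \<Rightarrow> ('n, 'm) primal_dual \<times> 'n control \<Rightarrow> ('n, 'm) primal_dual" where
  "pred_dir1 A z = (case z of ((x, s, y), (v0, v)) \<Rightarrow>
    newton_dir A (x, s, y) (((norm v)\<^sup>2 / (real CARD('n) + 1)) *\<^sub>R 1 - v\<^sup>2 - x * s))"

definition pred_dir2 ::
    "real^'n^'m \<Rightarrow> ('n, 'm) primal_dual \<times> 'n control \<Rightarrow> ('n, 'm) primal_dual" where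
  "pred_dir2 A z = (case z of ((x, s, y), (v0, v)) \<Rightarrow> (case pred_dir1 A z of (dx, ds, dy) \<Rightarrow>
    newton_dir A (x, s, y) (v\<^sup>2 - ((norm v)\<^sup>2 / (real CARD('n) + 1)) *\<^sub>R 1 - dx * ds)))"

definition pred_point ::
    "real^'n^'m \<Rightarrow> ('n, 'm) primal_dual \<times> 'n control \<Rightarrow> real \<Rightarrow>
     ('n, 'm) primal_dual \<times> 'n control" where
  "pred_point A z \<alpha> =
    (fst z + \<alpha> *\<^sub>R pred_dir1 A z + \<alpha>\<^sup>2 *\<^sub>R pred_dir2 A z, (1 - \<alpha>) *\<^sub>R snd z)"

definition predictor_step ::
    "real^'n^'m \<Rightarrow> real^'m \<Rightarrow> real^'n \<Rightarrow> real \<Rightarrow> ('n, 'm) primal_dual \<times> 'n control \<Rightarrow> real \<Rightarrow>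
     ('n, 'm) primal_dual \<times> 'n control \<Rightarrow> bool" where
  "predictor_step A b c r z \<alpha> z' \<longleftrightarrow>
     0 < \<alpha> \<and> \<alpha> < 1 \<and> pred_point A z \<alpha> \<in> interior_set A b c \<and>
     proximity (pred_point A z \<alpha>) = omega_star r \<and> z' = pred_point A z \<alpha>"

definition corr_point ::
    "real^'n^'m \<Rightarrow> ('n, 'm) primal_dual \<times> 'n control \<Rightarrow> real \<Rightarrow>
     ('n, 'm) primal_dual \<times> 'n control" where
  "corr_point A z \<alpha> =
    (fst z + \<alpha> *\<^sub>R newton_dir A (fst z) (rho (snd z) *\<^sub>R 1 - resid_tail z), snd z)"

text \<open>An approximate minimizer is one up to an additive error \<open>\<eta>\<close> in the function value.\<close>

definition corrector_step ::
    "real^'n^'m \<Rightarrow> real^'m \<Rightarrow> real^'n \<Rightarrow> real \<Rightarrow> ('n, 'm) primal_dual \<times> 'n control \<Rightarrow> real \<Rightarrow>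
     ('n, 'm) primal_dual \<times> 'n control \<Rightarrow> bool" where
  "corrector_step A b c \<eta> z \<alpha> z' \<longleftrightarrow>
     0 \<le> \<alpha> \<and> corr_point A z \<alpha> \<in> interior_set A b c \<and>
     (\<forall>\<alpha>'\<ge>0. corr_point A z \<alpha>' \<in> interior_set A b c \<longrightarrow>
        barrier (corr_point A z \<alpha>) \<le> barrier (corr_point A z \<alpha>') + \<eta>) \<and>
     z' = corr_point A z \<alpha>"

text \<open>The sequences \<open>z\<close> and \<open>\<alpha>\<close> record \<open>N\<close> iterations (numbered \<open>0, \<dots>, N - 1\<close>) of the method
  with accuracy \<open>\<epsilon>\<close>, the line search of iteration \<open>k\<close> having tolerance \<open>\<eta> k\<close>.  Each of them is
  carried out, i.e. the stopping test fails at \<open>z 0, \<dots>, z (N - 1)\<close>.\<close>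

definition PTFM2_run ::
    "real^'n^'m \<Rightarrow> real^'m \<Rightarrow> real^'n \<Rightarrow> real \<Rightarrow> real \<Rightarrow> (nat \<Rightarrow> real) \<Rightarrow> nat \<Rightarrow>
     (nat \<Rightarrow> ('n, 'm) primal_dual \<times> 'n control) \<Rightarrow> (nat \<Rightarrow> real) \<Rightarrow> bool" where
  "PTFM2_run A b c r \<epsilon> \<eta> N z \<alpha> \<longleftrightarrow>
     fst (z 0) \<in> strictly_feasible A b c \<and>
     snd (z 0) = initial_control (fst (z 0)) \<and>
     (\<forall>k<N. \<not> (fst (snd (z k)) \<le> \<epsilon> \<and> delta_measure (z k) \<le> beta_param r) \<and>
        (if delta_measure (z k) \<le> beta_param r
         then predictor_step A b c r (z k) (\<alpha> k) (z (Suc k))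
         else corrector_step A b c (\<eta> k) (z k) (\<alpha> k) (z (Suc k))))"

definition mu_star :: "'n::finite control \<Rightarrow> real" where
  "mu_star w = (case w of (v0, v) \<Rightarrow> v0\<^sup>2 / (v0 - (norm v)\<^sup>2))"

definition n_r :: "nat \<Rightarrow> real \<Rightarrow> real" where
  "n_r n r = 25 / 6 + real n / (1 - beta_param r)"

definition n_hat :: "nat \<Rightarrow> real \<Rightarrow> real" where
  "n_hat n r = sqrt (16 / 27 * (real n + 1) + 1 / 2 * (n_r n r)\<^sup>2)"

definition n_bar :: "nat \<Rightarrow> real \<Rightarrow> real" where
  "n_bar n r = max (n_hat n r) (n_r n r)"

definition gamma2 :: "nat \<Rightarrow> real \<Rightarrow> real" where
  "gamma2 n r =
    (let \<beta> = beta_param r; q = root 3 (r / 2 * sqrt (1 - \<beta>))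
     in q / (sqrt (n_bar n r) * (1 + 1 / 6 * root 3 (r / (2 * (1 - \<beta>)))) + q))"

end

theory Submission
  imports Defs
begin

text \<open>
  Write \<open>\<rho> = rho w\<close>, \<open>\<tau> = (norm v)\<^sup>2 / (n + 1)\<close>, \<open>\<beta> = beta_param r\<close> and \<open>c = 1 - \<beta>\<close>.  Along the
  predictor curve both \<open>\<rho>\<close> and the residuals have a simple form: \<open>\<rho>\<close> becomes
  \<open>(1 - \<alpha>) (\<rho> + \<alpha> \<tau>)\<close>, and \<open>resid\<close> becomes \<open>(1 - \<alpha>) (resid + \<alpha> \<tau>)\<close> plus an error
  \<open>\<alpha>^3 P + \<alpha>^4 Q\<close> in the components other than \<open>None\<close> (\<open>predictor_residual\<close>), the second
  direction having removed the quadratic term.  Consequently \<open>mu_star\<close> is multiplied by exactly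
  \<open>(1 - \<alpha>) \<rho> / (\<rho> + \<alpha> \<tau>)\<close> (\<open>mu_star_scale\<close>), and it remains to see that \<open>\<alpha>\<close> cannot be too small.

  The condition \<open>delta_measure z \<le> \<beta>\<close> gives \<open>resid \<ge> c \<rho>\<close> and
  \<open>norm (resid / \<rho> - 1) \<le> \<beta> / (1 - \<beta>) = r / 2\<close> (\<open>delta_measure_bounds\<close>).  With the lower bound
  on the residuals, the energies \<open>\<Sum>i. (d $ i)\<^sup>2 / (x $ i * s $ i)\<close> of the right-hand sides of the
  two Newton systems are at most \<open>N (\<rho> + \<tau>)\<^sup>2 / \<rho>\<close> and \<open>N\<^sup>2 (\<rho> + \<tau>)^4 / (c \<rho>^3)\<close>, where
  \<open>N = n_bar n r\<close> (\<open>predictor_energy_le\<close>, \<open>second_order_energy_le\<close>); since the primal and dual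
  parts of each direction are orthogonal, these energies control \<open>P\<close> and \<open>Q\<close>
  (\<open>newton_product_bounds\<close>).

  Now suppose that \<open>mu_star\<close> decreased by less than the claimed factor.  Then \<open>\<alpha>\<close> is so small that
  the error, relative to the new \<open>\<rho>\<close>, has norm below \<open>r / 2\<close> (\<open>higher_order_terms_lt\<close>).  The new
  residuals thus satisfy \<open>norm (resid / \<rho> - 1) < r\<close> (\<open>predictor_residual_deviation_lt\<close>).  But
  \<open>proximity \<le> omega_star (norm (resid / \<rho> - 1))\<close> because the components of \<open>resid / \<rho> - 1\<close> sum to
  zero (\<open>proximity_le_omega_star\<close>), so the new proximity is below \<open>omega_star r\<close>, contrary to the
  choice of \<open>\<alpha>\<close>.
\<close>

section \<open>Coordinates\<close>

lemma power2_vec_nth [simp]: "(v\<^sup>2) $ i = (v $ i)\<^sup>2" for v :: "real^'n"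
  by (simp add: power2_eq_square)

lemma power2_norm_vec: "(norm v)\<^sup>2 = (\<Sum>i\<in>UNIV. (v $ i)\<^sup>2)" for v :: "real^'n::finite"
  unfolding power2_norm_eq_inner by (simp add: inner_vec_def power2_eq_square)

lemma sum_option_UNIV:
  "(\<Sum>j\<in>UNIV. f j) = f None + (\<Sum>i\<in>UNIV. f (Some i))" for f :: "'n::finite option \<Rightarrow> real"
  by (simp add: UNIV_option_conv sum.reindex)

lemma norm_option_vec:
  fixes u :: "real^'n::finite"
  shows "norm (\<chi> j. case j of None \<Rightarrow> 0 | Some i \<Rightarrow> u $ i) = norm u"
proof -
  have "(norm (\<chi> j. case j of None \<Rightarrow> 0 | Some i \<Rightarrow> u $ i))\<^sup>2 = (norm u)\<^sup>2"
    unfolding power2_norm_vec sum_option_UNIV by simp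
  thus ?thesis by simp
qed

section \<open>The Newton system\<close>

lemma inner_null_space_row_space:
  fixes A :: "real^'n^'m"
  assumes "A *v p = 0" "q + transpose A *v y = 0"
  shows "p \<bullet> q = 0"
proof -
  have "q = - (y v* A)" using assms(2) by (simp add: eq_neg_iff_add_eq_0)
  thus ?thesis using assms(1) by (simp add: dot_lmul_matrix inner_commute[of p])
qed

lemma newton_system_injective:
  fixes A :: "real^'n^'m"
  assumes rk: "rank A = CARD('m)" and x: "\<And>i. x $ i > 0" and s: "\<And>i. s $ i > 0"
    and eq: "x * q + s * p = 0" and p: "A *v p = 0" and q: "q + transpose A *v y = 0"
  shows "p = 0 \<and> q = 0 \<and> y = 0"
proof -
  have q_eq: "q $ i = - (s $ i / x $ i * p $ i)" for i
  proof -
    have "(x * q + s * p) $ i = 0" by (simp add: eq)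
    thus ?thesis using x[of i] by (simp add: field_simps)
  qed
  have "(\<Sum>i\<in>UNIV. s $ i / x $ i * (p $ i)\<^sup>2) = - (p \<bullet> q)"
    by (simp add: inner_vec_def q_eq sum_negf power2_eq_square mult_ac)
  also have "\<dots> = 0" using inner_null_space_row_space[OF p q] by simp
  finally have "\<forall>i\<in>UNIV. s $ i / x $ i * (p $ i)\<^sup>2 = 0"
    by (subst (asm) sum_nonneg_eq_0_iff) (auto simp: less_imp_le x s)
  hence "p = 0" using x s by (auto simp: vec_eq_iff less_le)
  moreover have "q = 0" using q_eq \<open>p = 0\<close> by (simp add: vec_eq_iff)
  moreover have "y = 0"
  proof -
    have "rank (transpose A) = CARD('m)" using rk by (simp add: rank_transpose)
    hence "inj ((*v) (transpose A))" by (simp add: full_rank_injective)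
    moreover have "transpose A *v y = transpose A *v 0" using q \<open>q = 0\<close> by simp
    ultimately show ?thesis by (meson injD)
  qed
  ultimately show ?thesis by simp
qed

lemma newton_dir_solves:
  fixes A :: "real^'n^'m"
  assumes rk: "rank A = CARD('m)" and x: "\<And>i. x $ i > 0" and s: "\<And>i. s $ i > 0"
  obtains p q y' where "newton_dir A (x, s, y) d = (p, q, y')"
    "x * q + s * p = d" "A *v p = 0" "q + transpose A *v y' = 0"
proof -
  \<comment> \<open>Domain and codomain coincide, so that injectivity implies surjectivity.\<close>
  define L :: "(real^'n) \<times> (real^'n) \<times> (real^'m) \<Rightarrow> (real^'n) \<times> (real^'n) \<times> (real^'m)"
    where "L = (\<lambda>u. (x * fst (snd u) + s * fst u, fst (snd u) + transpose A *v snd (snd u), A *v fst u))"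
  have lin: "linear L"
    by (rule linearI)
      (auto simp: L_def vec_eq_iff algebra_simps matrix_vector_right_distrib
        matrix_vector_mult_scaleR vector_matrix_mul_rid scaleR_vector_matrix_assoc
        simp flip: transpose_matrix_vector)
  have inj: "inj L"
  proof (subst linear_injective_0[OF lin], intro allI impI)
    fix u assume "L u = 0"
    hence "x * fst (snd u) + s * fst u = 0" "A *v fst u = 0"
      "fst (snd u) + transpose A *v snd (snd u) = 0"
      by (auto simp: L_def zero_prod_def)
    from newton_system_injective[OF rk x s this] show "u = 0" by (simp add: prod_eq_iff)
  qed
  have "surj L" using linear_injective_imp_surjective[OF lin inj] by simp
  then obtain u where u: "L u = (d, 0, 0)" by (metis surjD)
  have iff: "L (a, b, e) = (d, 0, 0) \<longleftrightarrow> (a, b, e) = u" for a b e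
    using inj u by (metis injD)
  have "newton_dir A (x, s, y) d = (THE (a, b, e). L (a, b, e) = (d, 0, 0))"
    by (simp add: newton_dir_def L_def conj_commute conj_left_commute)
  also have "\<dots> = u" unfolding iff by (cases u) auto
  finally have "newton_dir A (x, s, y) d = (fst u, fst (snd u), snd (snd u))" by simp
  thus ?thesis by (rule that) (use u in \<open>auto simp: L_def\<close>)
qed

section \<open>Products of Newton directions\<close>

text \<open>The scaled directions \<open>sqrt (s / x) * p\<close> and \<open>sqrt (x / s) * q\<close> are orthogonal and sum to
  \<open>d / sqrt (x * s)\<close>; the identity is Pythagoras' theorem for them.\<close>

lemma newton_energy:
  fixes x s p q d :: "real^'n::finite"
  assumes x: "\<And>i. x $ i > 0" and s: "\<And>i. s $ i > 0"
    and eq: "x * q + s * p = d" and orth: "p \<bullet> q = 0"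
  shows "(\<Sum>i\<in>UNIV. s $ i / x $ i * (p $ i)\<^sup>2) + (\<Sum>i\<in>UNIV. x $ i / s $ i * (q $ i)\<^sup>2)
       = (\<Sum>i\<in>UNIV. (d $ i)\<^sup>2 / (x $ i * s $ i))"
proof -
  have "(d $ i)\<^sup>2 / (x $ i * s $ i)
      = s $ i / x $ i * (p $ i)\<^sup>2 + x $ i / s $ i * (q $ i)\<^sup>2 + 2 * (p $ i * q $ i)" for i
  proof -
    have "d $ i = x $ i * q $ i + s $ i * p $ i" using eq by auto
    thus ?thesis using x[of i] s[of i] by (simp add: field_simps power2_eq_square)
  qed
  hence "(\<Sum>i\<in>UNIV. (d $ i)\<^sup>2 / (x $ i * s $ i))
      = (\<Sum>i\<in>UNIV. s $ i / x $ i * (p $ i)\<^sup>2) + (\<Sum>i\<in>UNIV. x $ i / s $ i * (q $ i)\<^sup>2) + 2 * (p \<bullet> q)"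
    by (simp add: sum.distrib sum_distrib_left inner_vec_def)
  thus ?thesis using orth by simp
qed

lemma norm_product_le_energy:
  fixes x s p q :: "real^'n::finite"
  assumes x: "\<And>i. x $ i > 0" and s: "\<And>i. s $ i > 0"
  shows "(norm (p * q))\<^sup>2 \<le>
    (\<Sum>i\<in>UNIV. s $ i / x $ i * (p $ i)\<^sup>2) * (\<Sum>i\<in>UNIV. x $ i / s $ i * (q $ i)\<^sup>2)"
proof -
  have "(norm (p * q))\<^sup>2 = (\<Sum>i\<in>UNIV. (s $ i / x $ i * (p $ i)\<^sup>2) * (x $ i / s $ i * (q $ i)\<^sup>2))"
    unfolding power2_norm_vec
    by (intro sum.cong refl) (use x s in \<open>simp add: power_mult_distrib less_le\<close>)
  also have "\<dots> \<le> (\<Sum>i\<in>UNIV. s $ i / x $ i * (p $ i)\<^sup>2) * (\<Sum>i\<in>UNIV. x $ i / s $ i * (q $ i)\<^sup>2)"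
  proof -
    have "(\<Sum>i\<in>UNIV. (s $ i / x $ i * (p $ i)\<^sup>2) * (x $ i / s $ i * (q $ i)\<^sup>2))
        \<le> (\<Sum>i\<in>UNIV. (s $ i / x $ i * (p $ i)\<^sup>2) * (\<Sum>j\<in>UNIV. x $ j / s $ j * (q $ j)\<^sup>2))"
      by (intro sum_mono mult_left_mono member_le_sum) (auto simp: less_imp_le x s)
    thus ?thesis by (simp add: sum_distrib_right)
  qed
  finally show ?thesis .
qed

lemma newton_product_bounds:
  fixes x s p q d p' q' d' :: "real^'n::finite"
  assumes x: "\<And>i. x $ i > 0" and s: "\<And>i. s $ i > 0"
    and eq: "x * q + s * p = d" and orth: "p \<bullet> q = 0"
    and eq': "x * q' + s * p' = d'" and orth': "p' \<bullet> q' = 0"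
    and M: "(\<Sum>i\<in>UNIV. (d $ i)\<^sup>2 / (x $ i * s $ i)) \<le> M\<^sup>2" "0 \<le> M"
    and M': "(\<Sum>i\<in>UNIV. (d' $ i)\<^sup>2 / (x $ i * s $ i)) \<le> M'\<^sup>2" "0 \<le> M'"
  shows "norm (p * q' + p' * q) \<le> M * M'" "norm (p' * q') \<le> M'\<^sup>2 / 2"
proof -
  define E where "E p = (\<Sum>i\<in>UNIV. s $ i / x $ i * (p $ i)\<^sup>2)" for p :: "real^'n"
  define G where "G q = (\<Sum>i\<in>UNIV. x $ i / s $ i * (q $ i)\<^sup>2)" for q :: "real^'n"
  have nn: "E p \<ge> 0" "G p \<ge> 0" for p
    unfolding E_def G_def by (intro sum_nonneg; simp add: less_imp_le x s)+
  have e: "E p + G q \<le> M\<^sup>2" "E p' + G q' \<le> M'\<^sup>2"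
    using newton_energy[OF x s eq orth] newton_energy[OF x s eq' orth'] M M'
    by (simp_all add: E_def G_def)
  have prod: "norm (a * b) \<le> sqrt (E a) * sqrt (G b)" for a b
    using norm_product_le_energy[OF x s, of a b] unfolding E_def[symmetric] G_def[symmetric]
    by (metis abs_norm_cancel real_sqrt_abs real_sqrt_le_iff real_sqrt_mult)
  have "norm (p * q' + p' * q) \<le> sqrt (E p) * sqrt (G q') + sqrt (E p') * sqrt (G q)"
    by (intro order_trans[OF norm_triangle_ineq] add_mono prod)
  also have "\<dots> \<le> sqrt ((E p + G q) * (E p' + G q'))"
  proof (rule real_le_rsqrt)
    let ?a = "sqrt (E p)" and ?b = "sqrt (G q')" and ?c = "sqrt (E p')" and ?e = "sqrt (G q)"
    have "(?a * ?b + ?c * ?e)\<^sup>2 + (?a * ?c - ?e * ?b)\<^sup>2 = (?a\<^sup>2 + ?e\<^sup>2) * (?c\<^sup>2 + ?b\<^sup>2)"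
      by (simp add: power2_eq_square algebra_simps)
    also have "\<dots> = (E p + G q) * (E p' + G q')" by (simp add: nn)
    finally show "(?a * ?b + ?c * ?e)\<^sup>2 \<le> (E p + G q) * (E p' + G q')"
      by (metis add_increasing2 le_add_same_cancel1 order_refl zero_le_power2 order_trans)
  qed
  also have "\<dots> \<le> sqrt (M\<^sup>2 * M'\<^sup>2)"
    by (intro real_sqrt_le_mono mult_mono e) (use nn in \<open>auto intro: add_nonneg_nonneg\<close>)
  also have "\<dots> = M * M'" using M M' by (simp add: real_sqrt_mult)
  finally show "norm (p * q' + p' * q) \<le> M * M'" .
  have "norm (p' * q') \<le> (E p' + G q') / 2"
    using prod[of p' q'] arith_geo_mean_sqrt[OF nn(1)[of p'] nn(2)[of q']]
    by (simp add: real_sqrt_mult)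
  thus "norm (p' * q') \<le> M'\<^sup>2 / 2" using e by simp
qed

section \<open>Consequences of a small local proximity measure\<close>

text \<open>For the normalised residual \<open>\<xi>\<close> the hypothesis says \<open>\<chi>\<^sub>1\<^sup>2 \<le> \<beta> \<chi>\<^sub>2\<close>.  Since
  \<open>1 / \<xi> $ j \<le> 1 + \<chi>\<^sub>2\<close> and \<open>\<xi> $ j \<le> 1 + \<chi>\<^sub>0\<close>, also \<open>\<chi>\<^sub>2\<^sup>2 / (1 + \<chi>\<^sub>2) \<le> \<chi>\<^sub>1\<^sup>2\<close> and
  \<open>\<chi>\<^sub>0\<^sup>2 / (1 + \<chi>\<^sub>0) \<le> \<chi>\<^sub>1\<^sup>2\<close>.  The first yields \<open>\<chi>\<^sub>2 \<le> \<beta> / (1 - \<beta>)\<close>, hence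
  \<open>\<chi>\<^sub>1\<^sup>2 \<le> \<beta>\<^sup>2 / (1 - \<beta>)\<close>, and the second then yields \<open>\<chi>\<^sub>0 \<le> \<beta> / (1 - \<beta>)\<close>.\<close>

lemma proximity_bounds:
  fixes \<xi> :: "real^'k::finite"
  assumes pos: "\<And>j. \<xi> $ j > 0" and b: "0 \<le> \<beta>" "\<beta> < 1"
    and le: "(\<Sum>j\<in>UNIV. (\<xi> $ j - 1)\<^sup>2 / \<xi> $ j) \<le> \<beta> * sqrt (\<Sum>j\<in>UNIV. ((\<xi> $ j - 1) / \<xi> $ j)\<^sup>2)"
  shows "\<xi> $ j \<ge> 1 - \<beta>" "norm (\<xi> - 1) \<le> \<beta> / (1 - \<beta>)"
proof -
  define t :: "real^'k" where "t = (\<chi> j. (\<xi> $ j - 1) / \<xi> $ j)"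
  define X where "X = (\<Sum>j\<in>UNIV. (\<xi> $ j - 1)\<^sup>2 / \<xi> $ j)"
  have le': "X \<le> \<beta> * norm t"
    using le by (simp add: X_def t_def norm_vec_def L2_set_def power_divide)
  have low: "1 \<le> \<xi> $ j * (1 + norm t)" for j
  proof -
    have "- norm t \<le> t $ j" using component_le_norm_cart[of t j] by linarith
    hence "\<xi> $ j * (- norm t) \<le> \<xi> $ j * t $ j" using pos[of j] by (intro mult_left_mono) auto
    also have "\<dots> = \<xi> $ j - 1" using pos[of j] by (simp add: t_def)
    finally show ?thesis by (simp add: algebra_simps)
  qed
  have "(norm t)\<^sup>2 \<le> (1 + norm t) * X"
  proof -
    have "(t $ j)\<^sup>2 \<le> (1 + norm t) * ((\<xi> $ j - 1)\<^sup>2 / \<xi> $ j)" for j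
    proof -
      have "(1 + norm t) * ((\<xi> $ j - 1)\<^sup>2 / \<xi> $ j) = (\<xi> $ j * (1 + norm t)) * (t $ j)\<^sup>2"
        using pos[of j] by (simp add: t_def power2_eq_square field_simps)
      moreover have "1 * (t $ j)\<^sup>2 \<le> (\<xi> $ j * (1 + norm t)) * (t $ j)\<^sup>2"
        by (intro mult_right_mono low) auto
      ultimately show ?thesis by simp
    qed
    thus ?thesis unfolding power2_norm_vec[of t] X_def sum_distrib_left by (intro sum_mono) auto
  qed
  also have "\<dots> \<le> (1 + norm t) * (\<beta> * norm t)" by (intro mult_left_mono le') auto
  finally have "norm t * norm t \<le> norm t * (\<beta> * (1 + norm t))"
    by (simp add: power2_eq_square mult_ac)
  hence "norm t \<le> \<beta> * (1 + norm t)"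
    using b by (cases "norm t = 0") (simp_all only: mult_le_cancel_left_pos, auto)
  hence tb: "norm t * (1 - \<beta>) \<le> \<beta>" by (simp add: algebra_simps)
  have "(1 + norm t) * (1 - \<beta>) \<le> 1" using tb by (simp add: algebra_simps)
  hence "(1 + norm t) * (1 - \<beta>) \<le> (1 + norm t) * \<xi> $ j" for j
    using low[of j] by (simp add: mult.commute)
  thus "\<xi> $ j \<ge> 1 - \<beta>" for j
    by (smt (verit) mult_le_cancel_left_pos norm_ge_zero)
  define a where "a = norm (\<xi> - 1)"
  have a0: "a \<ge> 0" by (simp add: a_def)
  have "a\<^sup>2 \<le> (1 + a) * X"
  proof -
    have "((\<xi> - 1) $ j)\<^sup>2 \<le> (1 + a) * ((\<xi> $ j - 1)\<^sup>2 / \<xi> $ j)" for j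
    proof -
      have "\<xi> $ j \<le> 1 + a" using component_le_norm_cart[of "\<xi> - 1" j] by (simp add: a_def)
      hence "\<xi> $ j * ((\<xi> $ j - 1)\<^sup>2 / \<xi> $ j) \<le> (1 + a) * ((\<xi> $ j - 1)\<^sup>2 / \<xi> $ j)"
        using pos[of j] by (intro mult_right_mono) (auto simp: less_imp_le)
      thus ?thesis using pos[of j] by simp
    qed
    thus ?thesis unfolding a_def power2_norm_vec[of "\<xi> - 1"] X_def sum_distrib_left
      by (intro sum_mono) auto
  qed
  also have "X \<le> \<beta>\<^sup>2 / (1 - \<beta>)"
  proof -
    have "norm t \<le> \<beta> / (1 - \<beta>)" using tb b by (simp add: pos_le_divide_eq)
    hence "\<beta> * norm t \<le> \<beta> * (\<beta> / (1 - \<beta>))" using b by (intro mult_left_mono)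
    thus ?thesis using le' by (simp add: power2_eq_square)
  qed
  finally have "a\<^sup>2 \<le> (1 + a) * (\<beta>\<^sup>2 / (1 - \<beta>))" using a0 by simp
  hence q: "a\<^sup>2 * (1 - \<beta>) \<le> (1 + a) * \<beta>\<^sup>2"
    using b by (simp add: pos_le_divide_eq)
  have "(a * (1 - \<beta>) - \<beta>) * (a + \<beta>) = a\<^sup>2 * (1 - \<beta>) - (1 + a) * \<beta>\<^sup>2"
    by (simp add: algebra_simps power2_eq_square)
  hence n: "(a * (1 - \<beta>) - \<beta>) * (a + \<beta>) \<le> 0" using q by simp
  have "a * (1 - \<beta>) \<le> \<beta>"
  proof (cases "a + \<beta> = 0")
    case False
    thus ?thesis using n a0 b by (simp add: mult_le_0_iff)
  next
    case True
    hence "a = 0" using a0 b by linarith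
    thus ?thesis using b by simp
  qed
  thus "norm (\<xi> - 1) \<le> \<beta> / (1 - \<beta>)" using b by (simp add: a_def pos_le_divide_eq)
qed

lemma delta_measure_bounds:
  fixes z :: "('n::finite, 'm::finite) primal_dual \<times> 'n control"
  assumes pos: "\<And>j. resid z $ j > 0" "rho (snd z) > 0" and b: "0 \<le> \<beta>" "\<beta> < 1"
    and d: "delta_measure z \<le> \<beta>"
  shows "resid z $ j \<ge> (1 - \<beta>) * rho (snd z)"
    "norm (resid z /\<^sub>R rho (snd z) - 1) \<le> \<beta> / (1 - \<beta>)"
proof -
  define \<rho> where "\<rho> = rho (snd z)"
  define \<xi> where "\<xi> = resid z /\<^sub>R \<rho>"
  have r: "\<rho> > 0" "\<And>j. resid z $ j > 0" using pos by (simp_all add: \<rho>_def)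
  have c1: "(chi_measure 1 z)\<^sup>2 = (\<Sum>j\<in>UNIV. (\<xi> $ j - 1)\<^sup>2 / \<xi> $ j)"
  proof -
    have "(resid z $ j - \<rho>)\<^sup>2 / (resid z $ j ^ 1 * \<rho> ^ (2 - 1)) = (\<xi> $ j - 1)\<^sup>2 / \<xi> $ j" for j
      using r(1) r(2)[of j] by (simp add: \<xi>_def field_simps power2_eq_square)
    moreover have "(\<xi> $ j - 1)\<^sup>2 / \<xi> $ j \<ge> 0" for j using r by (simp add: \<xi>_def less_imp_le)
    ultimately show ?thesis
      unfolding chi_measure_def \<rho>_def[symmetric] by (simp add: sum_nonneg)
  qed
  have c2: "chi_measure 2 z = sqrt (\<Sum>j\<in>UNIV. ((\<xi> $ j - 1) / \<xi> $ j)\<^sup>2)"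
  proof -
    have "(resid z $ j - \<rho>)\<^sup>2 / (resid z $ j ^ 2 * \<rho> ^ (2 - 2)) = ((\<xi> $ j - 1) / \<xi> $ j)\<^sup>2" for j
      using r(1) r(2)[of j] by (simp add: \<xi>_def field_simps power2_eq_square)
    thus ?thesis unfolding chi_measure_def \<rho>_def[symmetric] by simp
  qed
  have xpos: "\<And>j. \<xi> $ j > 0" using r by (simp add: \<xi>_def)
  have "(chi_measure 1 z)\<^sup>2 \<le> \<beta> * chi_measure 2 z"
  proof (cases "chi_measure 2 z = 0")
    case True
    hence "\<forall>j\<in>UNIV. ((\<xi> $ j - 1) / \<xi> $ j)\<^sup>2 = 0"
      unfolding c2 real_sqrt_eq_0_iff by (subst (asm) sum_nonneg_eq_0_iff) auto
    hence "(\<xi> $ j - 1)\<^sup>2 / \<xi> $ j = 0" for j by auto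
    thus ?thesis using True unfolding c1 by (simp only: sum.neutral_const mult_zero_right order_refl)
  next
    case False
    moreover have "chi_measure 2 z \<ge> 0" unfolding c2 by (simp add: sum_nonneg)
    ultimately show ?thesis using d by (simp add: delta_measure_def pos_divide_le_eq)
  qed
  hence *: "(\<Sum>j\<in>UNIV. (\<xi> $ j - 1)\<^sup>2 / \<xi> $ j) \<le> \<beta> * sqrt (\<Sum>j\<in>UNIV. ((\<xi> $ j - 1) / \<xi> $ j)\<^sup>2)"
    by (simp only: c1 c2)
  show "resid z $ j \<ge> (1 - \<beta>) * rho (snd z)"
    using proximity_bounds(1)[OF xpos b *, of j] r(1)
    by (simp add: \<xi>_def \<rho>_def field_simps)
  show "norm (resid z /\<^sub>R rho (snd z) - 1) \<le> \<beta> / (1 - \<beta>)"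
    using proximity_bounds(2)[OF xpos b *] by (simp add: \<xi>_def \<rho>_def)
qed

section \<open>The functional proximity measure and \<open>omega_star\<close>\<close>

lemma omega_star_strict_mono:
  assumes "0 \<le> R" "R < r" "r < 1"
  shows "omega_star R < omega_star r"
proof (rule DERIV_pos_imp_increasing_open[OF assms(2)])
  fix x assume "R < x" "x < r"
  thus "\<exists>y. (omega_star has_real_derivative y) (at x) \<and> 0 < y"
    using assms unfolding omega_star_def
    by (intro exI[of _ "x / (1 - x)"] conjI) 
       (auto intro!: derivative_eq_intros simp: field_simps)
next
  show "continuous_on {R..r} omega_star"
    using assms unfolding omega_star_def by (intro continuous_intros) auto
qed

text \<open>The function \<open>omega_star t / t\<^sup>2\<close> is increasing.\<close>

lemma omega_star_scaled_le:
  fixes t R :: real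
  assumes "0 < t" "t \<le> R" "R < 1"
  shows "omega_star t \<le> t\<^sup>2 / R\<^sup>2 * omega_star R"
proof -
  \<comment> \<open>The numerator of the derivative of \<open>omega_star x / x\<^sup>2\<close> is \<open>x\<close> times the difference of the two sides.\<close>
  have two: "2 * omega_star x \<le> x\<^sup>2 / (1 - x)" if "0 \<le> x" "x < 1" for x :: real
  proof -
    have "0\<^sup>2 / (1 - 0) - 2 * omega_star 0 \<le> x\<^sup>2 / (1 - x) - 2 * omega_star x"
    proof (rule DERIV_nonneg_imp_nondecreasing[OF that(1)])
      fix u assume "0 \<le> u" "u \<le> x"
      hence "u < 1" using that by simp
      have "((\<lambda>x. x\<^sup>2 / (1 - x) - 2 * omega_star x) has_real_derivative
          (2 * u * (1 - u) + u\<^sup>2) / (1 - u)\<^sup>2 - 2 * (- 1 + 1 / (1 - u))) (at u)"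
        unfolding omega_star_def using \<open>u < 1\<close>
        by (auto intro!: derivative_eq_intros simp: power2_eq_square)
      moreover have "(2 * u * (1 - u) + u\<^sup>2) / (1 - u)\<^sup>2 - 2 * (- 1 + 1 / (1 - u)) = u\<^sup>2 / (1 - u)\<^sup>2"
        using \<open>u < 1\<close> by (simp add: divide_simps) (simp add: power2_eq_square algebra_simps)
      ultimately show "\<exists>y. ((\<lambda>x. x\<^sup>2 / (1 - x) - 2 * omega_star x) has_real_derivative y) (at u) \<and> 0 \<le> y"
        by (metis divide_nonneg_nonneg zero_le_power2)
    qed
    thus ?thesis by (simp add: omega_star_def)
  qed
  have "omega_star t / t\<^sup>2 \<le> omega_star R / R\<^sup>2"
  proof (rule DERIV_nonneg_imp_nondecreasing[OF assms(2)])
    fix u assume "t \<le> u" "u \<le> R"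
    hence u: "0 < u" "u < 1" using assms by auto
    have "((\<lambda>x. omega_star x / x\<^sup>2) has_real_derivative
       ((- 1 + 1 / (1 - u)) * u\<^sup>2 - omega_star u * (2 * u)) / (u\<^sup>2 * u\<^sup>2)) (at u)"
      unfolding omega_star_def using u
      by (auto intro!: derivative_eq_intros)
    moreover have "(- 1 + 1 / (1 - u)) * u\<^sup>2 - omega_star u * (2 * u)
        = u * (u\<^sup>2 / (1 - u) - 2 * omega_star u)"
      using u by (simp add: field_simps power2_eq_square)
    moreover have "u * (u\<^sup>2 / (1 - u) - 2 * omega_star u) \<ge> 0" using two[of u] u by simp
    ultimately show "\<exists>y. ((\<lambda>x. omega_star x / x\<^sup>2) has_real_derivative y) (at u) \<and> 0 \<le> y"
      by (metis divide_nonneg_nonneg mult_nonneg_nonneg zero_le_power2)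
  qed
  thus ?thesis using assms by (simp add: field_simps)
qed

lemma minus_ln_one_plus_le_omega_star:
  fixes h :: real
  assumes "\<bar>h\<bar> < 1"
  shows "h - ln (1 + h) \<le> omega_star \<bar>h\<bar>"
proof (cases "h \<ge> 0")
  case True
  have "ln (1 + 0) - ln (1 - 0) - 2 * 0 \<le> ln (1 + h) - ln (1 - h) - 2 * h"
  proof (rule DERIV_nonneg_imp_nondecreasing[OF True])
    fix u assume "0 \<le> u" "u \<le> h"
    hence u: "0 \<le> u" "u < 1" using assms by auto
    hence "1 / (1 + u) + 1 / (1 - u) - 2 = 2 * u\<^sup>2 / ((1 + u) * (1 - u))"
      by (simp add: divide_simps) (simp add: power2_eq_square algebra_simps)
    hence "1 / (1 + u) + 1 / (1 - u) - 2 \<ge> 0" using u by simp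
    moreover have "((\<lambda>x. ln (1 + x) - ln (1 - x) - 2 * x) has_real_derivative
        1 / (1 + u) + 1 / (1 - u) - 2) (at u)"
      using u by (auto intro!: derivative_eq_intros)
    ultimately show "\<exists>y. ((\<lambda>x. ln (1 + x) - ln (1 - x) - 2 * x) has_real_derivative y) (at u) \<and> 0 \<le> y"
      by blast
  qed
  thus ?thesis using True by (simp add: omega_star_def)
qed (simp add: omega_star_def)

text \<open>The norm of \<open>h\<close> dominates each component, so by the preceding two lemmas each summand
  \<open>h $ j - ln (1 + h $ j)\<close> is at most the share \<open>(h $ j)\<^sup>2 / (norm h)\<^sup>2\<close> of the right-hand side.\<close>

lemma minus_sum_ln_le_omega_star:
  fixes h :: "real^'k::finite"
  assumes "(\<Sum>j\<in>UNIV. h $ j) = 0" "norm h < 1"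
  shows "- (\<Sum>j\<in>UNIV. ln (1 + h $ j)) \<le> omega_star (norm h)"
proof (cases "h = 0")
  case True
  thus ?thesis by (simp add: omega_star_def)
next
  case False
  have "h $ j - ln (1 + h $ j) \<le> (h $ j)\<^sup>2 / (norm h)\<^sup>2 * omega_star (norm h)" for j
  proof (cases "h $ j = 0")
    case False
    have "\<bar>h $ j\<bar> \<le> norm h" by (rule component_le_norm_cart)
    thus ?thesis using minus_ln_one_plus_le_omega_star[of "h $ j"]
        omega_star_scaled_le[of "\<bar>h $ j\<bar>" "norm h"] False assms by simp
  qed simp
  hence "(\<Sum>j\<in>UNIV. h $ j - ln (1 + h $ j))
      \<le> (\<Sum>j\<in>UNIV. (h $ j)\<^sup>2 / (norm h)\<^sup>2 * omega_star (norm h))"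
    by (intro sum_mono)
  also have "\<dots> = (norm h)\<^sup>2 / (norm h)\<^sup>2 * omega_star (norm h)"
    by (simp add: power2_norm_vec flip: sum_distrib_right sum_divide_distrib)
  finally show ?thesis using assms False by (simp add: sum_subtractf)
qed

lemma sum_resid:
  fixes z :: "('n::finite, 'm::finite) primal_dual \<times> 'n control"
  shows "(\<Sum>j\<in>UNIV. resid z $ j) = (real CARD('n) + 1) * rho (snd z)"
  unfolding sum_option_UNIV
  by (cases z)
    (auto simp: resid_def rho_def power2_norm_vec inner_vec_def sum_subtractf mult.commute
      simp flip: of_nat_Suc split: prod.splits)

lemma proximity_eq:
  fixes z :: "('n::finite, 'm::finite) primal_dual \<times> 'n control"
  assumes "\<And>j. resid z $ j > 0" "rho (snd z) > 0"
  shows "proximity z = - (\<Sum>j\<in>UNIV. ln (1 + (resid z /\<^sub>R rho (snd z) - 1) $ j))"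
proof -
  have "ln (1 + (resid z /\<^sub>R rho (snd z) - 1) $ j) = ln (resid z $ j) - ln (rho (snd z))" for j
    using assms(1)[of j] assms(2) by (simp add: ln_mult ln_inverse)
  hence "(\<Sum>j\<in>UNIV. ln (1 + (resid z /\<^sub>R rho (snd z) - 1) $ j))
      = (\<Sum>j\<in>UNIV. ln (resid z $ j) - ln (rho (snd z)))" by (simp only:)
  thus ?thesis
    unfolding proximity_def barrier_def by (simp only: sum_subtractf) (simp add: algebra_simps)
qed

lemma proximity_le_omega_star:
  fixes z :: "('n::finite, 'm::finite) primal_dual \<times> 'n control"
  assumes pos: "\<And>j. resid z $ j > 0" "rho (snd z) > 0"
    and lt: "norm (resid z /\<^sub>R rho (snd z) - 1) < 1"
  shows "proximity z \<le> omega_star (norm (resid z /\<^sub>R rho (snd z) - 1))"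
  unfolding proximity_eq[OF pos]
proof (rule minus_sum_ln_le_omega_star[OF _ lt])
  show "(\<Sum>j\<in>UNIV. (resid z /\<^sub>R rho (snd z) - 1) $ j) = 0"
    using pos(2) by (simp add: sum_subtractf sum_resid flip: sum_distrib_left) (simp add: field_simps)
qed

section \<open>Size of the predictor directions\<close>

lemma mult_power2_le_power3_add: "27 * (t * \<rho>\<^sup>2) \<le> 4 * (\<rho> + t) ^ 3" if "0 \<le> t" "0 < \<rho>" for t \<rho> :: real
proof -
  have "4 * (\<rho> + t) ^ 3 - 27 * (t * \<rho>\<^sup>2) = (4 * t + 16 * \<rho>) * (t - \<rho> / 2)\<^sup>2"
    by (simp add: power2_eq_square power3_eq_cube algebra_simps)
  moreover have "\<dots> \<ge> 0" using that by simp
  ultimately show ?thesis by linarith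
qed

text \<open>In the next three lemmas, \<open>w i\<close> stands for \<open>(v $ i)\<^sup>2\<close> and \<open>X i\<close> for \<open>x $ i * s $ i\<close>, so that
  \<open>X i - w i\<close> is a residual.\<close>

lemma weighted_deviation_le:
  fixes X w :: "'n::finite \<Rightarrow> real"
  assumes \<rho>: "0 < \<rho>" and c: "0 < c" and w: "\<And>i. 0 \<le> w i"
    and X: "\<And>i. c * \<rho> + w i \<le> X i" and \<tau>: "0 \<le> \<tau>" "(\<Sum>i\<in>UNIV. w i) = (real CARD('n) + 1) * \<tau>"
  shows "(\<Sum>i\<in>UNIV. (\<tau> - w i)\<^sup>2 / X i) \<le> (real CARD('n) + 1) * \<tau> + real CARD('n) * (\<tau>\<^sup>2 / (c * \<rho>))"
proof -
  have cr: "c * \<rho> > 0" using \<rho> c by simp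
  have "(\<tau> - w i)\<^sup>2 / X i \<le> w i + \<tau>\<^sup>2 / (c * \<rho>)" for i
  proof -
    have Xp: "X i > 0" using X[of i] w[of i] cr by linarith
    have nn: "0 \<le> \<tau> * w i" "0 \<le> \<tau>\<^sup>2 / (c * \<rho>) * w i" "0 \<le> c * \<rho> * w i"
      using w \<tau> cr by simp_all
    have "(\<tau> - w i)\<^sup>2 = (w i)\<^sup>2 + \<tau>\<^sup>2 - 2 * (\<tau> * w i)" by (simp add: power2_eq_square algebra_simps)
    also have "\<dots> \<le> (w i)\<^sup>2 + \<tau>\<^sup>2 + \<tau>\<^sup>2 / (c * \<rho>) * w i + c * \<rho> * w i" using nn by linarith
    also have "\<dots> = (w i + \<tau>\<^sup>2 / (c * \<rho>)) * (c * \<rho> + w i)"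
    proof -
      have "u\<^sup>2 + T + T / k * u + k * u = (u + T / k) * (k + u)" if "k > 0" for u T k :: real
        using that by (simp add: field_simps power2_eq_square)
      thus ?thesis using cr by blast
    qed
    also have "\<dots> \<le> (w i + \<tau>\<^sup>2 / (c * \<rho>)) * X i"
      using w[of i] cr by (intro mult_left_mono X) auto
    finally show ?thesis using Xp by (simp add: pos_divide_le_eq)
  qed
  hence "(\<Sum>i\<in>UNIV. (\<tau> - w i)\<^sup>2 / X i) \<le> (\<Sum>i\<in>UNIV. w i + \<tau>\<^sup>2 / (c * \<rho>))" by (intro sum_mono)
  thus ?thesis by (simp add: sum.distrib \<tau>)
qed

text \<open>The energy of the right-hand side of the first Newton system.\<close>

lemma predictor_energy_le:
  fixes X w :: "'n::finite \<Rightarrow> real"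
  assumes \<rho>: "0 < \<rho>" and c: "0 < c" "c \<le> 1" and w: "\<And>i. 0 \<le> w i"
    and X: "\<And>i. c * \<rho> + w i \<le> X i" and \<tau>: "0 \<le> \<tau>" "(\<Sum>i\<in>UNIV. w i) = (real CARD('n) + 1) * \<tau>"
    and S: "(\<Sum>i\<in>UNIV. X i) \<le> (real CARD('n) + 1) * (\<rho> + \<tau>)"
  shows "(\<Sum>i\<in>UNIV. (\<tau> - w i - X i)\<^sup>2 / X i)
    \<le> (25 / 6 + real CARD('n) / c) * ((\<rho> + \<tau>)\<^sup>2 / \<rho>)"
proof -
  define n where "n = real CARD('n)"
  have n: "n \<ge> 1" by (simp add: n_def Suc_leI)
  have Xp: "X i > 0" for i
    using X[of i] w[of i] mult_pos_pos[OF c(1) \<rho>] by linarith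
  have "(\<tau> - w i - X i)\<^sup>2 / X i = (\<tau> - w i)\<^sup>2 / X i - 2 * (\<tau> - w i) + X i" for i
    using Xp[of i] by (simp add: field_simps power2_eq_square)
  hence "(\<Sum>i\<in>UNIV. (\<tau> - w i - X i)\<^sup>2 / X i)
      = (\<Sum>i\<in>UNIV. (\<tau> - w i)\<^sup>2 / X i) - 2 * (\<Sum>i\<in>UNIV. \<tau> - w i) + (\<Sum>i\<in>UNIV. X i)"
    by (simp add: sum.distrib sum_subtractf sum_distrib_left)
  also have "(\<Sum>i\<in>UNIV. \<tau> - w i) = - \<tau>"
    using \<tau>(2) by (simp add: sum_subtractf algebra_simps)
  finally have "(\<Sum>i\<in>UNIV. (\<tau> - w i - X i)\<^sup>2 / X i)
      \<le> (n + 1) * \<tau> + n * (\<tau>\<^sup>2 / (c * \<rho>)) + 2 * \<tau> + (n + 1) * (\<rho> + \<tau>)"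
    using weighted_deviation_le[OF \<rho> c(1) w X \<tau>] S unfolding n_def by linarith
  also have "\<dots> = (n + 1) * \<rho> + (n + 2) * (2 * \<tau>) + n / c * (\<tau>\<^sup>2 / \<rho>)"
    by (simp add: algebra_simps)
  also have "\<dots> \<le> (25 / 6 + n / c) * \<rho> + (25 / 6 + n / c) * (2 * \<tau>) + (25 / 6 + n / c) * (\<tau>\<^sup>2 / \<rho>)"
  proof -
    have "n \<le> n / c" using c n by (simp add: pos_le_divide_eq mult_left_le)
    hence "n + 1 \<le> 25 / 6 + n / c" "n + 2 \<le> 25 / 6 + n / c" "n / c \<le> 25 / 6 + n / c"
      by linarith+
    from this(1)[THEN mult_right_mono, of \<rho>] this(2)[THEN mult_right_mono, of "2 * \<tau>"]
      this(3)[THEN mult_right_mono, of "\<tau>\<^sup>2 / \<rho>"] show ?thesis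
      using \<rho> \<tau> by (intro add_mono) auto
  qed
  also have "\<dots> = (25 / 6 + n / c) * ((\<rho> + \<tau>)\<^sup>2 / \<rho>)"
  proof -
    have "(\<rho> + \<tau>)\<^sup>2 / \<rho> = \<rho> + 2 * \<tau> + \<tau>\<^sup>2 / \<rho>" using \<rho> by (simp add: field_simps power2_eq_square)
    thus ?thesis by (simp only: distrib_left)
  qed
  finally show ?thesis by (simp add: n_def)
qed

text \<open>The energy of the right-hand side of the second Newton system, where \<open>e\<close> is the product of the
  two parts of the first direction.  The constant \<open>16 / 27\<close> arises from the maximum \<open>4 / 27\<close> of
  \<open>\<tau> \<rho>\<^sup>2 / (\<rho> + \<tau>) ^ 3\<close>; half of it would suffice.\<close>

lemma second_order_energy_le:
  fixes X w e :: "'n::finite \<Rightarrow> real"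
  assumes \<rho>: "0 < \<rho>" and c: "0 < c" "c \<le> 1" and w: "\<And>i. 0 \<le> w i"
    and X: "\<And>i. c * \<rho> + w i \<le> X i" and \<tau>: "0 \<le> \<tau>" "(\<Sum>i\<in>UNIV. w i) = (real CARD('n) + 1) * \<tau>"
    and e: "(\<Sum>i\<in>UNIV. (e i)\<^sup>2) \<le> (K * ((\<rho> + \<tau>)\<^sup>2 / \<rho>) / 2)\<^sup>2"
  shows "(\<Sum>i\<in>UNIV. (w i - \<tau> - e i)\<^sup>2 / X i)
    \<le> (16 / 27 * (real CARD('n) + 1) + 1 / 2 * K\<^sup>2) * ((\<rho> + \<tau>) ^ 4 / (c * \<rho> ^ 3))"
proof -
  define n where "n = real CARD('n)"
  have n: "n \<ge> 1" by (simp add: n_def Suc_leI)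
  have cr: "c * \<rho> > 0" using c \<rho> by simp
  have Xp: "X i \<ge> c * \<rho>" for i using X[of i] w[of i] by linarith
  have "(w i - \<tau> - e i)\<^sup>2 / X i \<le> 2 * ((\<tau> - w i)\<^sup>2 / X i) + 2 * ((e i)\<^sup>2 / (c * \<rho>))" for i
  proof -
    have "(w i - \<tau> - e i)\<^sup>2 + (w i - \<tau> + e i)\<^sup>2 = 2 * (\<tau> - w i)\<^sup>2 + 2 * (e i)\<^sup>2"
      by (simp add: power2_eq_square algebra_simps)
    hence "(w i - \<tau> - e i)\<^sup>2 \<le> 2 * (\<tau> - w i)\<^sup>2 + 2 * (e i)\<^sup>2"
      using zero_le_power2[of "w i - \<tau> + e i"] by linarith
    hence "(w i - \<tau> - e i)\<^sup>2 / X i \<le> (2 * (\<tau> - w i)\<^sup>2 + 2 * (e i)\<^sup>2) / X i"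
      using Xp[of i] cr by (intro divide_right_mono) auto
    also have "\<dots> = 2 * ((\<tau> - w i)\<^sup>2 / X i) + 2 * ((e i)\<^sup>2 / X i)" by (simp add: add_divide_distrib)
    also have "(e i)\<^sup>2 / X i \<le> (e i)\<^sup>2 / (c * \<rho>)"
      using Xp[of i] cr by (intro divide_left_mono) auto
    finally show ?thesis by simp
  qed
  hence "(\<Sum>i\<in>UNIV. (w i - \<tau> - e i)\<^sup>2 / X i)
      \<le> (\<Sum>i\<in>UNIV. 2 * ((\<tau> - w i)\<^sup>2 / X i) + 2 * ((e i)\<^sup>2 / (c * \<rho>)))"
    by (intro sum_mono)
  also have "\<dots> = 2 * (\<Sum>i\<in>UNIV. (\<tau> - w i)\<^sup>2 / X i) + 2 * ((\<Sum>i\<in>UNIV. (e i)\<^sup>2) / (c * \<rho>))"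
    by (simp add: sum.distrib sum_distrib_left sum_divide_distrib)
  also have "\<dots> \<le> 2 * ((n + 1) * (\<tau> * (\<rho> + \<tau>) / (c * \<rho>))) + 2 * ((K * ((\<rho> + \<tau>)\<^sup>2 / \<rho>) / 2)\<^sup>2 / (c * \<rho>))"
  proof (intro add_mono mult_left_mono divide_right_mono e)
    have "(\<Sum>i\<in>UNIV. (\<tau> - w i)\<^sup>2 / X i) \<le> (n + 1) * \<tau> + n * (\<tau>\<^sup>2 / (c * \<rho>))"
      using weighted_deviation_le[OF \<rho> c(1) w X \<tau>] unfolding n_def .
    also have "\<dots> \<le> (n + 1) * (\<tau> / c) + (n + 1) * (\<tau>\<^sup>2 / (c * \<rho>))"
      using n cr \<tau> c by (intro add_mono mult_mono mult_left_mono) (auto simp: pos_le_divide_eq mult_left_le)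
    also have "\<dots> = (n + 1) * (\<tau> * (\<rho> + \<tau>) / (c * \<rho>))"
      using \<rho> c by (simp add: field_simps power2_eq_square)
    finally show "(\<Sum>i\<in>UNIV. (\<tau> - w i)\<^sup>2 / X i) \<le> (n + 1) * (\<tau> * (\<rho> + \<tau>) / (c * \<rho>))" .
  qed (use cr in auto)
  also have "2 * ((K * ((\<rho> + \<tau>)\<^sup>2 / \<rho>) / 2)\<^sup>2 / (c * \<rho>)) = 1 / 2 * K\<^sup>2 * ((\<rho> + \<tau>) ^ 4 / (c * \<rho> ^ 3))"
  proof -
    have "2 * ((K * (S\<^sup>2 / \<rho>) / 2)\<^sup>2 / (c * \<rho>)) = 1 / 2 * K\<^sup>2 * (S ^ 4 / (c * \<rho> ^ 3))" for S
      using \<rho> c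
      by (simp add: power_divide power_mult_distrib power2_eq_square power3_eq_cube power4_eq_xxxx mult_ac)
    thus ?thesis by blast
  qed
  also have "2 * ((n + 1) * (\<tau> * (\<rho> + \<tau>) / (c * \<rho>)))
      \<le> 16 / 27 * (n + 1) * ((\<rho> + \<tau>) ^ 4 / (c * \<rho> ^ 3))"
  proof -
    have "27 * (\<tau> * \<rho>\<^sup>2) \<le> 4 * (\<rho> + \<tau>) ^ 3" by (rule mult_power2_le_power3_add[OF \<tau>(1) \<rho>])
    moreover have "0 \<le> (\<rho> + \<tau>) ^ 3" using \<rho> \<tau> by simp
    ultimately have "2 * (\<tau> * \<rho>\<^sup>2) \<le> 16 / 27 * (\<rho> + \<tau>) ^ 3" by linarith
    hence "(2 * (\<tau> * \<rho>\<^sup>2)) * ((\<rho> + \<tau>) / (c * \<rho> ^ 3)) \<le> (16 / 27 * (\<rho> + \<tau>) ^ 3) * ((\<rho> + \<tau>) / (c * \<rho> ^ 3))"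
      using \<rho> \<tau> c by (intro mult_right_mono) auto
    hence "2 * (\<tau> * (\<rho> + \<tau>) / (c * \<rho>)) \<le> 16 / 27 * ((\<rho> + \<tau>) ^ 4 / (c * \<rho> ^ 3))"
      using \<rho> c by (simp add: power2_eq_square power3_eq_cube power4_eq_xxxx mult_ac)
    hence "(n + 1) * (2 * (\<tau> * (\<rho> + \<tau>) / (c * \<rho>))) \<le> (n + 1) * (16 / 27 * ((\<rho> + \<tau>) ^ 4 / (c * \<rho> ^ 3)))"
      using n by (intro mult_left_mono) auto
    thus ?thesis by (simp only: mult_ac)
  qed
  finally show ?thesis by (simp only: n_def distrib_right)
qed

section \<open>Controls and residuals along the predictor curve\<close>

lemma mu_star_scale:
  fixes w :: "'n::finite control"
  assumes w: "w \<in> control_set" and \<alpha>: "0 < \<alpha>" "\<alpha> < 1"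
  defines "\<rho> \<equiv> rho w" and "\<tau> \<equiv> (norm (snd w))\<^sup>2 / (real CARD('n) + 1)"
  shows "rho ((1 - \<alpha>) *\<^sub>R w) = (1 - \<alpha>) * (\<rho> + \<alpha> * \<tau>)"
    "mu_star ((1 - \<alpha>) *\<^sub>R w) = (1 - \<alpha>) * \<rho> / (\<rho> + \<alpha> * \<tau>) * mu_star w"
proof -
  obtain v0 v where w_eq: "w = (v0, v)" by (cases w)
  define n where "n = real CARD('n) + 1"
  have n: "n > 0" by (simp add: n_def)
  have v0: "v0 = n * (\<rho> + \<tau>)" and nv: "(norm v)\<^sup>2 = n * \<tau>"
    using n by (simp_all add: \<rho>_def \<tau>_def w_eq rho_def flip: n_def add_divide_distrib)
  have nv': "(norm ((1 - \<alpha>) *\<^sub>R v))\<^sup>2 = (1 - \<alpha>)\<^sup>2 * (n * \<tau>)" by (simp add: power_mult_distrib nv)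
  have \<rho>: "\<rho> > 0" using w n by (auto simp: \<rho>_def w_eq rho_def control_set_def simp flip: n_def)
  have \<tau>: "\<tau> \<ge> 0" by (simp add: \<tau>_def)
  have d: "(1 - \<alpha>) * v0 - (norm ((1 - \<alpha>) *\<^sub>R v))\<^sup>2 = n * ((1 - \<alpha>) * (\<rho> + \<alpha> * \<tau>))"
    unfolding nv' v0 by (simp add: power2_eq_square algebra_simps)
  have "rho ((1 - \<alpha>) *\<^sub>R w) = ((1 - \<alpha>) * v0 - (norm ((1 - \<alpha>) *\<^sub>R v))\<^sup>2) / n"
    by (simp add: rho_def w_eq n_def)
  thus "rho ((1 - \<alpha>) *\<^sub>R w) = (1 - \<alpha>) * (\<rho> + \<alpha> * \<tau>)" unfolding d using n by simp
  have "mu_star ((1 - \<alpha>) *\<^sub>R w)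
      = ((1 - \<alpha>) * v0)\<^sup>2 / ((1 - \<alpha>) * v0 - (norm ((1 - \<alpha>) *\<^sub>R v))\<^sup>2)"
    by (simp add: mu_star_def w_eq)
  moreover have "mu_star w = v0\<^sup>2 / (n * \<rho>)" 
    using nv v0 by (simp add: mu_star_def w_eq distrib_left)
  moreover have "\<rho> + \<alpha> * \<tau> > 0" using \<rho> \<tau> \<alpha> by (simp add: add_pos_nonneg)
  moreover have "(k * v0)\<^sup>2 / (n * (k * R)) = k * \<rho> / R * (v0\<^sup>2 / (n * \<rho>))" if "k > 0" "R > 0" for k R
    using that n \<rho> by (simp add: power2_eq_square mult_ac)
  ultimately show "mu_star ((1 - \<alpha>) *\<^sub>R w) = (1 - \<alpha>) * \<rho> / (\<rho> + \<alpha> * \<tau>) * mu_star w"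
    unfolding d using \<alpha> by simp
qed

text \<open>\<open>P\<close> collects the mixed products of the first and second directions, \<open>Q\<close> is the product of the
  two parts of the second one.  The bound on the second energy is only needed for products of the
  size that the first energy admits.\<close>

lemma predictor_residual:
  fixes A :: "real^'n^'m" and z :: "('n, 'm) primal_dual \<times> 'n control"
  assumes rk: "rank A = CARD('m)" and z: "z \<in> interior_set A b c"
    and K1: "(\<Sum>i\<in>UNIV. (\<tau> - (snd (snd z) $ i)\<^sup>2 - fst (fst z) $ i * fst (snd (fst z)) $ i)\<^sup>2
        / (fst (fst z) $ i * fst (snd (fst z)) $ i)) \<le> M\<^sup>2" "0 \<le> M"
    and K2: "\<And>e :: real^'n. norm e \<le> M\<^sup>2 / 2 \<Longrightarrow>
      (\<Sum>i\<in>UNIV. ((snd (snd z) $ i)\<^sup>2 - \<tau> - e $ i)\<^sup>2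
        / (fst (fst z) $ i * fst (snd (fst z)) $ i)) \<le> M'\<^sup>2" "0 \<le> M'"
    and \<tau>: "\<tau> = (norm (snd (snd z)))\<^sup>2 / (real CARD('n) + 1)"
  obtains P Q :: "real^'n" where "norm P \<le> M * M'" "norm Q \<le> M'\<^sup>2 / 2"
    "\<And>\<alpha>. resid (pred_point A z \<alpha>)
      = (1 - \<alpha>) *\<^sub>R (resid z + (\<alpha> * \<tau>) *\<^sub>R 1)
        + (\<chi> j. case j of None \<Rightarrow> 0 | Some i \<Rightarrow> \<alpha> ^ 3 * P $ i + \<alpha> ^ 4 * Q $ i)"
proof -
  obtain x s y v0 v where z_eq: "z = ((x, s, y), (v0, v))" by (cases z) auto
  have x: "\<And>i. x $ i > 0" and s: "\<And>i. s $ i > 0" 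
    using z by (auto simp: z_eq interior_set_def strictly_feasible_def)
  define d where "d = \<tau> *\<^sub>R 1 - v\<^sup>2 - x * s"
  obtain p q y1 where N1: "newton_dir A (x, s, y) d = (p, q, y1)"
    and sys: "x * q + s * p = d" "A *v p = 0" "q + transpose A *v y1 = 0"
    using newton_dir_solves[OF rk x s] by blast
  define d' where "d' = v\<^sup>2 - \<tau> *\<^sub>R 1 - p * q"
  obtain p' q' y2 where N2: "newton_dir A (x, s, y) d' = (p', q', y2)"
    and sys': "x * q' + s * p' = d'" "A *v p' = 0" "q' + transpose A *v y2 = 0"
    using newton_dir_solves[OF rk x s] by blast
  have orth: "p \<bullet> q = 0" "p' \<bullet> q' = 0" "p \<bullet> q' = 0" "p' \<bullet> q = 0"
    using inner_null_space_row_space sys(2,3) sys'(2,3) by blast+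
  have pd1: "pred_dir1 A z = (p, q, y1)"
    using N1 by (simp add: pred_dir1_def z_eq d_def \<tau>)
  have pd2: "pred_dir2 A z = (p', q', y2)"
    using N2 pd1 by (simp add: pred_dir2_def z_eq d'_def \<tau>)
  have pp: "pred_point A z \<alpha> = ((x + \<alpha> *\<^sub>R p + \<alpha>\<^sup>2 *\<^sub>R p', s + \<alpha> *\<^sub>R q + \<alpha>\<^sup>2 *\<^sub>R q',
      y + \<alpha> *\<^sub>R y1 + \<alpha>\<^sup>2 *\<^sub>R y2), ((1 - \<alpha>) * v0, (1 - \<alpha>) *\<^sub>R v))" for \<alpha>
    unfolding pred_point_def pd1 pd2 by (simp add: z_eq)
  define P where "P = p * q' + p' * q"
  define Q where "Q = p' * q'"
  have M1: "(\<Sum>i\<in>UNIV. (d $ i)\<^sup>2 / (x $ i * s $ i)) \<le> M\<^sup>2"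
    using K1 by (simp add: d_def z_eq)
  have pq: "norm (p * q) \<le> M\<^sup>2 / 2"
    by (rule newton_product_bounds(2)[OF x s sys(1) orth(1) sys(1) orth(1) M1 K1(2) M1 K1(2)])
  have M2: "(\<Sum>i\<in>UNIV. (d' $ i)\<^sup>2 / (x $ i * s $ i)) \<le> M'\<^sup>2"
    using K2(1)[OF pq] by (simp add: d'_def z_eq)
  note bounds = newton_product_bounds[OF x s sys(1) orth(1) sys'(1) orth(2) M1 K1(2) M2 K2(2)]
  have sumP: "(\<Sum>i\<in>UNIV. P $ i) = 0" and sumQ: "(\<Sum>i\<in>UNIV. Q $ i) = 0"
    using orth by (simp_all add: P_def Q_def inner_vec_def sum.distrib)
  show ?thesis
  proof (rule that)
    show "norm P \<le> M * M'" "norm Q \<le> M'\<^sup>2 / 2" using bounds by (simp_all add: P_def Q_def)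
    fix \<alpha>
    have R: "resid (pred_point A z \<alpha>) $ Some i
        = (1 - \<alpha>) * (resid z $ Some i + \<alpha> * \<tau>) + \<alpha> ^ 3 * P $ i + \<alpha> ^ 4 * Q $ i" for i
    proof -
      have e: "x $ i * q $ i + s $ i * p $ i = \<tau> - (v $ i)\<^sup>2 - x $ i * s $ i"
        using arg_cong[OF sys(1), of "\<lambda>u. u $ i"] by (simp add: d_def)
      have e': "x $ i * q' $ i + s $ i * p' $ i = (v $ i)\<^sup>2 - \<tau> - p $ i * q $ i"
        using arg_cong[OF sys'(1), of "\<lambda>u. u $ i"] by (simp add: d'_def)
      have "(x $ i + \<alpha> * p $ i + \<alpha>\<^sup>2 * p' $ i) * (s $ i + \<alpha> * q $ i + \<alpha>\<^sup>2 * q' $ i)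
        = x $ i * s $ i + \<alpha> * (x $ i * q $ i + s $ i * p $ i)
          + \<alpha>\<^sup>2 * ((x $ i * q' $ i + s $ i * p' $ i) + p $ i * q $ i)
          + \<alpha> ^ 3 * P $ i + \<alpha> ^ 4 * Q $ i"
        by (simp add: P_def Q_def power2_eq_square power3_eq_cube power4_eq_xxxx algebra_simps)
      also have "\<dots> = x $ i * s $ i + \<alpha> * (\<tau> - (v $ i)\<^sup>2 - x $ i * s $ i)
          + \<alpha>\<^sup>2 * ((v $ i)\<^sup>2 - \<tau>) + \<alpha> ^ 3 * P $ i + \<alpha> ^ 4 * Q $ i"
        by (simp only: e e') (simp add: algebra_simps)
      finally have mul: "(x $ i + \<alpha> * p $ i + \<alpha>\<^sup>2 * p' $ i) * (s $ i + \<alpha> * q $ i + \<alpha>\<^sup>2 * q' $ i) = \<dots>" .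
      have "resid (pred_point A z \<alpha>) $ Some i
          = (x $ i + \<alpha> * p $ i + \<alpha>\<^sup>2 * p' $ i) * (s $ i + \<alpha> * q $ i + \<alpha>\<^sup>2 * q' $ i) - ((1 - \<alpha>) * v $ i)\<^sup>2"
        unfolding pp by (simp add: resid_def)
      moreover have "resid z $ Some i = x $ i * s $ i - (v $ i)\<^sup>2" by (simp add: resid_def z_eq)
      ultimately show ?thesis
        by (simp only: mul) (simp add: power2_eq_square algebra_simps)
    qed
    \<comment> \<open>The component \<open>None\<close> follows from the others, because the residuals sum to \<open>(n + 1) * rho\<close>
      and the components of \<open>P\<close> and \<open>Q\<close> sum to zero.\<close>
    define n where "n = real CARD('n)"
    have nv: "(norm v)\<^sup>2 = (n + 1) * \<tau>" by (simp add: \<tau> z_eq n_def)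
    have tot: "(\<Sum>j\<in>UNIV. resid (pred_point A z \<alpha>) $ j) = (1 - \<alpha>) * ((\<Sum>j\<in>UNIV. resid z $ j) + (n + 1) * (\<alpha> * \<tau>))"
      unfolding sum_resid pp by (simp add: rho_def z_eq power_mult_distrib nv n_def[symmetric])
        (simp add: field_simps power2_eq_square)
    have N: "resid (pred_point A z \<alpha>) $ None = (1 - \<alpha>) * (resid z $ None + \<alpha> * \<tau>)"
      using tot by (simp add: sum_option_UNIV R sum.distrib sumP sumQ n_def flip: sum_distrib_left)
        (simp add: algebra_simps)
    show "resid (pred_point A z \<alpha>) = (1 - \<alpha>) *\<^sub>R (resid z + (\<alpha> * \<tau>) *\<^sub>R 1)
        + (\<chi> j. case j of None \<Rightarrow> 0 | Some i \<Rightarrow> \<alpha> ^ 3 * P $ i + \<alpha> ^ 4 * Q $ i)"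
      unfolding vec_eq_iff
    proof
      fix j
      show "resid (pred_point A z \<alpha>) $ j = ((1 - \<alpha>) *\<^sub>R (resid z + (\<alpha> * \<tau>) *\<^sub>R 1)
        + (\<chi> j. case j of None \<Rightarrow> 0 | Some i \<Rightarrow> \<alpha> ^ 3 * P $ i + \<alpha> ^ 4 * Q $ i)) $ j"
        by (cases j) (simp_all add: N R)
    qed
  qed
qed

section \<open>The length of the predictor step\<close>

text \<open>With \<open>E = 1 - \<alpha> - a\<close> and \<open>p = q / (6 * sqrt c)\<close>, the hypothesis bounds \<open>y\<close> by
  \<open>E * q / (1 + p)\<close>.  In particular \<open>y < q\<close>, so the quartic term is at most \<open>3 * p\<close> times the cubic
  one, and \<open>1 + 3 * p \<le> (1 + p) ^ 3\<close>.\<close>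

lemma higher_order_terms_lt:
  fixes a \<alpha> y q c r :: real
  assumes c: "0 < c" and r: "0 < r" and q: "0 < q" "q ^ 3 = r / 2 * sqrt c"
    and a: "0 < a" "0 < \<alpha>" "\<alpha> < 1" and y: "0 < y"
    and le: "y * (1 + q / (6 * sqrt c)) < (1 - \<alpha> - a) * q"
  shows "y ^ 3 / sqrt c + y ^ 4 / (2 * c) < r / 2 * (1 - \<alpha>)"
proof -
  define p where "p = q / (6 * sqrt c)"
  define E where "E = 1 - \<alpha> - a"
  have p: "p > 0" using q c by (simp add: p_def)
  have "0 < y * (1 + p)" using y p by simp
  hence Eq: "0 < E * q" using le by (simp add: p_def E_def)
  hence E: "0 < E" "E < 1 - \<alpha>" using q a by (auto simp: E_def zero_less_mult_iff)
  have E1: "E < 1" using E a by simp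
  have "y \<le> y * (1 + p)" using y p by simp
  also have "\<dots> < E * q" using le by (simp add: p_def E_def)
  also have "\<dots> < q" using E1 q by simp
  finally have yq: "y < q" .
  have "sqrt c * sqrt c = c" using c by simp
  hence "y ^ 3 / sqrt c + y ^ 4 / (2 * c) = y ^ 3 / sqrt c * (1 + y / (2 * sqrt c))"
    using c by (simp add: field_simps power3_eq_cube power4_eq_xxxx)
  also have "\<dots> \<le> y ^ 3 / sqrt c * (1 + p) ^ 3"
  proof (intro mult_left_mono)
    have "y / (2 * sqrt c) \<le> q / (2 * sqrt c)" using yq c by (intro divide_right_mono) auto
    also have "\<dots> = 3 * p" by (simp add: p_def)
    finally have "1 + y / (2 * sqrt c) \<le> 1 + 3 * p" by simp
    also have "\<dots> \<le> (1 + p) ^ 3"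
    proof -
      have "(1 + p) ^ 3 = 1 + 3 * p + 3 * p\<^sup>2 + p ^ 3"
        by (simp add: power2_eq_square power3_eq_cube algebra_simps)
      thus ?thesis using p by simp
    qed
    finally show "1 + y / (2 * sqrt c) \<le> (1 + p) ^ 3" .
  qed (use y c in auto)
  also have "\<dots> = (y * (1 + p)) ^ 3 / sqrt c" by (simp add: power_mult_distrib)
  also have "\<dots> \<le> (E * q) ^ 3 / sqrt c"
    using \<open>y * (1 + p) < E * q\<close> \<open>0 < y * (1 + p)\<close> c
    by (intro divide_right_mono power_mono) auto
  also have "\<dots> = r / 2 * E ^ 3" using c by (simp add: power_mult_distrib q(2))
  also have "\<dots> \<le> r / 2 * E"
    using E E1 r power_decreasing[of 1 3 E] by (intro mult_left_mono) auto
  also have "\<dots> < r / 2 * (1 - \<alpha>)" using E r by (intro mult_strict_left_mono) auto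
  finally show ?thesis .
qed

lemma gamma2_pos: "0 < gamma2 n r" if "0 < r" "r < 1"
proof -
  have "n_r n r > 0" using that by (simp add: n_r_def beta_param_def add_pos_nonneg)
  hence "n_bar n r > 0" by (simp add: n_bar_def less_max_iff_disj)
  moreover have "1 - beta_param r > 0" using that by (simp add: beta_param_def)
  hence "root 3 (r / 2 * sqrt (1 - beta_param r)) > 0" "root 3 (r / (2 * (1 - beta_param r))) > 0"
    using that by (simp_all add: zero_less_divide_iff)
  ultimately show ?thesis
    by (auto simp: gamma2_def Let_def intro!: divide_pos_pos add_pos_pos mult_pos_pos)
qed

text \<open>The hypothesis \<open>short\<close> says that the step \<open>\<alpha>\<close> decreases \<open>mu_star\<close> by less than the factor
  \<open>1 / (1 + gamma2 n r)\<close>.\<close>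

lemma predictor_residual_deviation_lt:
  fixes A :: "real^'n^'m" and z :: "('n, 'm) primal_dual \<times> 'n control"
  assumes rk: "rank A = CARD('m)" and z: "z \<in> interior_set A b c" and r: "0 < r" "r < 1"
    and \<delta>: "delta_measure z \<le> beta_param r" and \<alpha>: "0 < \<alpha>" "\<alpha> < 1"
    and \<rho>: "\<rho> = rho (snd z)" and \<tau>: "\<tau> = (norm (snd (snd z)))\<^sup>2 / (real CARD('n) + 1)"
    and short: "\<rho> + \<alpha> * \<tau> < (1 - \<alpha>) * \<rho> * (1 + gamma2 CARD('n) r)"
  shows "norm (resid (pred_point A z \<alpha>) /\<^sub>R ((1 - \<alpha>) * (\<rho> + \<alpha> * \<tau>)) - 1) < r"
proof -
  define n where "n = real CARD('n)"
  define \<beta> where "\<beta> = beta_param r"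
  define c where "c = 1 - \<beta>"
  have \<beta>: "0 \<le> \<beta>" "\<beta> < 1" "\<beta> / (1 - \<beta>) = r / 2"
    using r by (simp_all add: \<beta>_def beta_param_def field_simps)
  have c: "0 < c" "c \<le> 1" using \<beta> by (simp_all add: c_def)
  obtain x s y v0 v where z_eq: "z = ((x, s, y), (v0, v))" by (cases z) auto
  have \<tau>0: "\<tau> \<ge> 0" by (simp add: \<tau>)
  have \<rho>0: "\<rho> > 0" using z by (auto simp: \<rho> z_eq interior_set_def control_set_def rho_def)
  have rpos: "\<And>j. resid z $ j > 0" using z by (auto simp: z_eq interior_set_def)
  note prox = delta_measure_bounds[OF rpos \<rho>0[unfolded \<rho>] \<beta>(1,2) \<delta>[folded \<beta>_def], folded \<rho> c_def]
  define N where "N = n_bar CARD('n) r"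
  define K where "K = n_r CARD('n) r"
  have K: "K = 25 / 6 + n / c" by (simp add: K_def n_r_def n_def c_def \<beta>_def)
  have K0: "K > 0" using c by (simp add: K n_def add_pos_nonneg)
  have NK: "K \<le> N" by (simp add: N_def K_def n_bar_def)
  have NH: "16 / 27 * (n + 1) + 1 / 2 * K\<^sup>2 \<le> N\<^sup>2"
  proof -
    have "sqrt (16 / 27 * (n + 1) + 1 / 2 * K\<^sup>2) \<le> N"
      by (simp add: N_def n_bar_def n_hat_def n_def K_def)
    thus ?thesis using sqrt_le_D by blast
  qed
  have N0: "N > 0" using K0 NK by simp
  define \<sigma> where "\<sigma> = \<rho> + \<tau>"
  have \<sigma>: "\<sigma> > 0" using \<rho>0 \<tau>0 by (simp add: \<sigma>_def)
  define M where "M = sqrt (N * (\<sigma>\<^sup>2 / \<rho>))"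
  define M' where "M' = N * \<sigma>\<^sup>2 / (sqrt c * \<rho> * sqrt \<rho>)"
  have M: "M \<ge> 0" "M\<^sup>2 = N * (\<sigma>\<^sup>2 / \<rho>)" using N0 \<rho>0 by (simp_all add: M_def)
  have M': "M' \<ge> 0" "M'\<^sup>2 = N\<^sup>2 * (\<sigma> ^ 4 / (c * \<rho> ^ 3))"
  proof -
    show "M' \<ge> 0" using N0 \<rho>0 c by (simp add: M'_def)
    have "M'\<^sup>2 = (N * \<sigma>\<^sup>2)\<^sup>2 / (c * \<rho>\<^sup>2 * \<rho>)"
      using \<rho>0 c by (simp add: M'_def power_divide power_mult_distrib)
    thus "M'\<^sup>2 = N\<^sup>2 * (\<sigma> ^ 4 / (c * \<rho> ^ 3))"
      by (simp add: power3_eq_cube power2_eq_square power4_eq_xxxx mult_ac)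
  qed
  define w where "w = (\<lambda>i. (v $ i)\<^sup>2)"
  define X where "X = (\<lambda>i. x $ i * s $ i)"
  have w: "0 \<le> w i" for i by (simp add: w_def)
  have X: "c * \<rho> + w i \<le> X i" for i
    using prox(1)[of "Some i"] by (simp add: resid_def z_eq X_def w_def)
  have sw: "(\<Sum>i\<in>UNIV. w i) = (real CARD('n) + 1) * \<tau>"
    by (simp add: w_def \<tau> z_eq power2_norm_vec)
  have SX: "(\<Sum>i\<in>UNIV. X i) \<le> (real CARD('n) + 1) * (\<rho> + \<tau>)"
  proof -
    have "(real CARD('n) + 1) * (\<rho> + \<tau>) = v0"
      by (simp add: \<rho> \<tau> z_eq rho_def flip: add_divide_distrib)
    moreover have "(\<Sum>i\<in>UNIV. X i) < v0"
      using rpos[of None] by (simp add: resid_def z_eq X_def inner_vec_def mult.commute)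
    ultimately show ?thesis by simp
  qed
  have E1: "(\<Sum>i\<in>UNIV. (\<tau> - w i - X i)\<^sup>2 / X i) \<le> K * (\<sigma>\<^sup>2 / \<rho>)"
    using predictor_energy_le[OF \<rho>0 c w X \<tau>0 sw SX] by (simp add: K n_def \<sigma>_def)
  have E2: "(\<Sum>i\<in>UNIV. (w i - \<tau> - e $ i)\<^sup>2 / X i) \<le> M'\<^sup>2" if "norm e \<le> K * (\<sigma>\<^sup>2 / \<rho>) / 2" for e :: "real^'n"
  proof -
    have "(\<Sum>i\<in>UNIV. (e $ i)\<^sup>2) \<le> (K * ((\<rho> + \<tau>)\<^sup>2 / \<rho>) / 2)\<^sup>2"
      unfolding power2_norm_vec[symmetric] \<sigma>_def[symmetric] using that by (intro power_mono) auto
    from second_order_energy_le[OF \<rho>0 c w X \<tau>0 sw this]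
    have "(\<Sum>i\<in>UNIV. (w i - \<tau> - e $ i)\<^sup>2 / X i)
        \<le> (16 / 27 * (n + 1) + 1 / 2 * K\<^sup>2) * (\<sigma> ^ 4 / (c * \<rho> ^ 3))" by (simp add: n_def \<sigma>_def)
    also have "\<dots> \<le> M'\<^sup>2" unfolding M' using c \<rho>0 \<sigma> by (intro mult_right_mono NH) auto
    finally show ?thesis .
  qed
  define M1 where "M1 = sqrt (K * (\<sigma>\<^sup>2 / \<rho>))"
  have M1: "M1 \<ge> 0" "M1\<^sup>2 = K * (\<sigma>\<^sup>2 / \<rho>)" using K0 \<rho>0 by (simp_all add: M1_def)
  have "M1 \<le> M" unfolding M1_def M_def using NK \<rho>0 by (intro real_sqrt_le_mono mult_right_mono) auto
  obtain P Q :: "real^'n" where P: "norm P \<le> M1 * M'" and Q: "norm Q \<le> M'\<^sup>2 / 2"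
    and res: "\<And>\<alpha>. resid (pred_point A z \<alpha>) = (1 - \<alpha>) *\<^sub>R (resid z + (\<alpha> * \<tau>) *\<^sub>R 1)
        + (\<chi> j. case j of None \<Rightarrow> 0 | Some i \<Rightarrow> \<alpha> ^ 3 * P $ i + \<alpha> ^ 4 * Q $ i)"
    by (rule predictor_residual[OF rk z, of \<tau> M1 M'])
      (use E1 E2 M1 M' \<tau> in \<open>auto simp: z_eq w_def X_def\<close>)
  define G where "G = \<alpha> ^ 3 *\<^sub>R P + \<alpha> ^ 4 *\<^sub>R Q"
  define t where "t = \<alpha> * sqrt N * \<sigma> / \<rho>"
  have t: "t > 0" using \<alpha> N0 \<sigma> \<rho>0 by (simp add: t_def)
  have nG: "norm G \<le> \<rho> * (t ^ 3 / sqrt c + t ^ 4 / (2 * c))"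
  proof -
    have "M1 * M' \<le> M * M'" using \<open>M1 \<le> M\<close> M' by (intro mult_right_mono) auto
    with P have "norm P \<le> M * M'" by simp
    hence "norm G \<le> \<alpha> ^ 3 * (M * M') + \<alpha> ^ 4 * (M'\<^sup>2 / 2)"
      unfolding G_def using \<alpha> Q
      by (intro order_trans[OF norm_triangle_ineq] add_mono) (auto simp: mult_left_mono)
    also have "\<alpha> ^ 3 * (M * M') = \<rho> * (t ^ 3 / sqrt c)"
    proof -
      have "M = sqrt N * \<sigma> / sqrt \<rho>" using \<sigma> by (simp add: M_def real_sqrt_mult real_sqrt_divide)
      moreover have "M' = sqrt N * sqrt N * \<sigma>\<^sup>2 / (sqrt c * \<rho> * sqrt \<rho>)"
        using N0 by (simp add: M'_def)
      ultimately have "M * M' = (sqrt N * \<sigma>) ^ 3 / (sqrt c * \<rho> * (sqrt \<rho> * sqrt \<rho>))"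
        by (simp only:) (simp add: power2_eq_square power3_eq_cube mult_ac del: real_sqrt_mult_self)
      hence "M * M' = (sqrt N * \<sigma>) ^ 3 / (sqrt c * \<rho> * \<rho>)" using \<rho>0 by simp
      thus ?thesis using \<rho>0
        by (simp add: t_def power_divide power_mult_distrib) (simp add: power3_eq_cube mult_ac)
    qed
    also have "\<alpha> ^ 4 * (M'\<^sup>2 / 2) = \<rho> * (t ^ 4 / (2 * c))"
    proof -
      have "sqrt N ^ 4 = N\<^sup>2" using N0 by (metis less_imp_le numeral_Bit0 power_add power2_eq_square real_sqrt_pow2)
      thus ?thesis unfolding M' using \<rho>0
        by (simp add: t_def power_mult_distrib power_divide)
          (simp add: power3_eq_cube power4_eq_xxxx mult_ac)
    qed
    finally show ?thesis by (simp add: distrib_left)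
  qed
  define q where "q = root 3 (r / 2 * sqrt c)"
  have q: "q > 0" "q ^ 3 = r / 2 * sqrt c" using r c by (simp_all add: q_def)
  have root: "root 3 (r / (2 * c)) = q / sqrt c"
  proof (rule real_root_pos_unique)
    have "sqrt c ^ 3 = sqrt c * c" using c by (simp add: power3_eq_cube)
    thus "(q / sqrt c) ^ 3 = r / (2 * c)" using c by (simp add: power_divide q(2))
  qed (use q c in auto)
  define \<gamma> where "\<gamma> = gamma2 CARD('n) r"
  have \<gamma>: "\<gamma> = q / (sqrt N * (1 + q / (6 * sqrt c)) + q)"
    using root by (simp add: \<gamma>_def gamma2_def Let_def N_def q_def c_def \<beta>_def)
  have D: "sqrt N * (1 + q / (6 * sqrt c)) + q > 0" using N0 q c by (intro add_nonneg_pos) auto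
  \<comment> \<open>The hypothesis \<open>short\<close> now reads \<open>a < (1 - \<alpha>) * \<gamma>\<close>.\<close>
  define a where "a = \<alpha> * \<sigma> / \<rho>"
  have a: "a > 0" using \<alpha> \<sigma> \<rho>0 by (simp add: a_def)
  have "\<alpha> * \<sigma> < (1 - \<alpha>) * \<rho> * \<gamma>"
    using short by (simp add: \<sigma>_def \<gamma>_def algebra_simps)
  hence "a < (1 - \<alpha>) * \<gamma>" using \<rho>0 by (simp add: a_def pos_divide_less_eq mult_ac)
  hence "a * (sqrt N * (1 + q / (6 * sqrt c)) + q) < (1 - \<alpha>) * q"
    using D by (simp add: \<gamma> pos_less_divide_eq)
  hence "t * (1 + q / (6 * sqrt c)) < (1 - \<alpha> - a) * q"
    by (simp add: t_def a_def algebra_simps)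
  from higher_order_terms_lt[OF c(1) r(1) q a \<alpha> t this]
  have "\<rho> * (t ^ 3 / sqrt c + t ^ 4 / (2 * c)) < \<rho> * (r / 2 * (1 - \<alpha>))"
    using \<rho>0 by (intro mult_strict_left_mono)
  with nG have nG': "norm G < \<rho> * (r / 2 * (1 - \<alpha>))" by (rule order.strict_trans1)
  \<comment> \<open>The old deviation \<open>resid z / \<rho> - 1\<close> shrinks by the factor \<open>\<rho> / \<rho>'\<close>; each of the two terms
    of the new one has norm at most \<open>r / 2\<close>.\<close>
  define \<rho>' where "\<rho>' = \<rho> + \<alpha> * \<tau>"
  have \<rho>': "\<rho> \<le> \<rho>'" "\<rho>' > 0" using \<rho>0 \<tau>0 \<alpha> by (simp_all add: \<rho>'_def add_pos_nonneg)
  define H where "H = (\<chi> j. case j of None \<Rightarrow> 0 | Some i \<Rightarrow> G $ i)"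
  have "resid (pred_point A z \<alpha>) /\<^sub>R ((1 - \<alpha>) * \<rho>') - 1
      = (\<rho> / \<rho>') *\<^sub>R (resid z /\<^sub>R \<rho> - 1) + (1 / ((1 - \<alpha>) * \<rho>')) *\<^sub>R H"
    unfolding vec_eq_iff
  proof
    fix j
    have "((1 - \<alpha>) * (u + \<alpha> * \<tau>) + h) / ((1 - \<alpha>) * \<rho>') - 1
        = \<rho> / \<rho>' * (u / \<rho> - 1) + 1 / ((1 - \<alpha>) * \<rho>') * h" for u h
    proof -
      have "\<rho>' \<noteq> 0" "\<alpha> * \<tau> = \<rho>' - \<rho>" "1 - \<alpha> \<noteq> 0" using \<rho>' \<alpha> by (simp_all add: \<rho>'_def)
      thus ?thesis using \<rho>0 by (simp add: add_divide_distrib diff_divide_distrib right_diff_distrib)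
    qed
    from this[of "resid z $ j" "H $ j"]
    show "(resid (pred_point A z \<alpha>) /\<^sub>R ((1 - \<alpha>) * \<rho>') - 1) $ j
      = ((\<rho> / \<rho>') *\<^sub>R (resid z /\<^sub>R \<rho> - 1) + (1 / ((1 - \<alpha>) * \<rho>')) *\<^sub>R H) $ j"
      by (cases j) (simp_all add: res H_def G_def divide_inverse mult_ac)
  qed
  hence "norm (resid (pred_point A z \<alpha>) /\<^sub>R ((1 - \<alpha>) * \<rho>') - 1)
      \<le> norm ((\<rho> / \<rho>') *\<^sub>R (resid z /\<^sub>R \<rho> - 1)) + norm ((1 / ((1 - \<alpha>) * \<rho>')) *\<^sub>R H)"
    by (metis norm_triangle_ineq)
  also have "norm ((\<rho> / \<rho>') *\<^sub>R (resid z /\<^sub>R \<rho> - 1)) \<le> r / 2"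
  proof -
    have "norm ((\<rho> / \<rho>') *\<^sub>R (resid z /\<^sub>R \<rho> - 1)) = \<rho> / \<rho>' * norm (resid z /\<^sub>R \<rho> - 1)"
      using \<rho>0 \<rho>' by simp
    also have "\<dots> \<le> 1 * (r / 2)"
      using prox(2) \<beta>(3) \<rho>0 \<rho>' r c_def by (intro mult_mono) (auto simp: pos_divide_le_eq)
    finally show ?thesis by simp
  qed
  also have "norm ((1 / ((1 - \<alpha>) * \<rho>')) *\<^sub>R H) < r / 2"
  proof -
    have "norm ((1 / ((1 - \<alpha>) * \<rho>')) *\<^sub>R H) = norm G / ((1 - \<alpha>) * \<rho>')"
      using \<alpha> \<rho>' by (simp add: H_def norm_option_vec)
    also have "\<dots> < r / 2"
    proof -
      note nG'
      also have "\<rho> * (r / 2 * (1 - \<alpha>)) \<le> \<rho>' * (r / 2 * (1 - \<alpha>))"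
        using \<rho>' r \<alpha> by (intro mult_right_mono) auto
      finally show ?thesis using \<alpha> \<rho>' by (simp add: pos_divide_less_eq mult_ac)
    qed
    finally show ?thesis .
  qed
  finally show ?thesis by (simp add: \<rho>'_def)
qed

lemma predictor_step_mu_star_le:
  fixes A :: "real^'n^'m" and z :: "('n, 'm) primal_dual \<times> 'n control"
  assumes rk: "rank A = CARD('m)" and z: "z \<in> interior_set A b c" and r: "0 < r" "r < 1"
    and \<delta>: "delta_measure z \<le> beta_param r" and step: "predictor_step A b c r z \<alpha> z'"
  shows "mu_star (snd z') \<le> 1 / (1 + gamma2 CARD('n) r) * mu_star (snd z)"
proof (rule ccontr)
  assume neg: "\<not> ?thesis"
  have \<alpha>: "0 < \<alpha>" "\<alpha> < 1" and z': "z' = pred_point A z \<alpha>" "z' \<in> interior_set A b c"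
    "proximity z' = omega_star r"
    using step by (auto simp: predictor_step_def)
  define \<rho> where "\<rho> = rho (snd z)"
  define \<tau> where "\<tau> = (norm (snd (snd z)))\<^sup>2 / (real CARD('n) + 1)"
  have w: "snd z \<in> control_set" using z by (cases z) (auto simp: interior_set_def)
  have w': "snd z' = (1 - \<alpha>) *\<^sub>R snd z" by (simp add: z' pred_point_def)
  note scale = mu_star_scale[OF w \<alpha>, folded \<rho>_def \<tau>_def w']
  have \<rho>: "\<rho> > 0" using w by (auto simp: \<rho>_def control_set_def rho_def)
  have \<rho>': "\<rho> + \<alpha> * \<tau> > 0" using \<rho> \<alpha> by (simp add: \<tau>_def add_pos_nonneg)
  have \<gamma>: "gamma2 CARD('n) r > 0" using gamma2_pos[OF r] .
  have "\<rho> + \<alpha> * \<tau> < (1 - \<alpha>) * \<rho> * (1 + gamma2 CARD('n) r)"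
  proof (rule ccontr)
    assume "\<not> ?thesis"
    hence "(1 - \<alpha>) * \<rho> / (\<rho> + \<alpha> * \<tau>) \<le> 1 / (1 + gamma2 CARD('n) r)"
      using \<rho>' \<gamma> by (simp add: divide_simps)
    moreover have "mu_star (snd z) \<ge> 0"
      using w by (cases "snd z") (auto simp: mu_star_def control_set_def)
    ultimately show False using neg unfolding scale(2) by (blast intro: mult_right_mono)
  qed
  hence lt: "norm (resid z' /\<^sub>R rho (snd z') - 1) < r"
    unfolding scale(1) unfolding z'
    by (rule predictor_residual_deviation_lt[OF rk z r \<delta> \<alpha> \<rho>_def \<tau>_def])
  have pos: "\<And>j. resid z' $ j > 0" "rho (snd z') > 0"
    using z'(2) \<rho>' \<alpha> scale(1) by (cases z'; auto simp: interior_set_def)+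
  have "proximity z' \<le> omega_star (norm (resid z' /\<^sub>R rho (snd z') - 1))"
    by (rule proximity_le_omega_star[OF pos]) (use lt r in simp)
  also have "\<dots> < omega_star r" by (rule omega_star_strict_mono) (use lt r in auto)
  finally show False using z'(3) by simp
qed

section \<open>Interiority of the iterates\<close>

lemma initial_point_interior:
  fixes A :: "real^'n^'m"
  assumes u: "u \<in> strictly_feasible A b c"
  shows "(u, initial_control u) \<in> interior_set A b c"
proof -
  obtain x s y where u_eq: "u = (x, s, y)" by (cases u) auto
  define \<sigma> where "\<sigma> = Min (range (\<lambda>i. x $ i * s $ i))"
  have pos: "\<sigma> > 0" and le: "\<And>i. \<sigma> \<le> x $ i * s $ i"
    using u by (auto simp: \<sigma>_def u_eq strictly_feasible_def)
  define v :: "real^'n" where "v = (\<chi> i. sqrt (x $ i * s $ i - \<sigma>))"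
  have ic: "initial_control u = (s \<bullet> x + \<sigma>, v)"
    by (simp add: initial_control_def u_eq Let_def \<sigma>_def v_def)
  have v2: "(v $ i)\<^sup>2 = x $ i * s $ i - \<sigma>" for i using le[of i] by (simp add: v_def)
  have "(norm v)\<^sup>2 = s \<bullet> x - real CARD('n) * \<sigma>"
    by (simp add: power2_norm_vec v2 sum_subtractf inner_vec_def mult.commute)
  moreover have "s \<bullet> x \<ge> 0"
    using u unfolding inner_vec_def
    by (intro sum_nonneg) (auto simp: u_eq strictly_feasible_def less_imp_le)
  moreover have "real CARD('n) * \<sigma> \<ge> 0" using pos by simp
  ultimately have "0 \<le> s \<bullet> x + \<sigma>" "(norm v)\<^sup>2 < s \<bullet> x + \<sigma>" using pos by linarith+
  hence "(s \<bullet> x + \<sigma>, v) \<in> control_set" by (simp add: control_set_def)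
  moreover have "resid (u, initial_control u) $ j > 0" for j
    using pos by (cases j) (simp_all add: resid_def u_eq ic[unfolded u_eq] v2)
  ultimately show ?thesis using u by (simp add: interior_set_def ic)
qed

lemma PTFM2_run_interior:
  assumes run: "PTFM2_run A b c r \<epsilon> \<eta> N z \<alpha>" and "k \<le> N"
  shows "z k \<in> interior_set A b c"
  using \<open>k \<le> N\<close>
proof (induction k)
  case 0
  show ?case using run initial_point_interior[of "fst (z 0)" A b c]
    by (metis PTFM2_run_def prod.collapse)
next
  case (Suc k)
  hence "if delta_measure (z k) \<le> beta_param r
         then predictor_step A b c r (z k) (\<alpha> k) (z (Suc k))
         else corrector_step A b c (\<eta> k) (z k) (\<alpha> k) (z (Suc k))"
    using run by (simp add: PTFM2_run_def)
  thus ?case by (auto simp: predictor_step_def corrector_step_def split: if_splits)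
qed

lemma fst_le_mu_star: "fst w \<le> mu_star w" if "w \<in> control_set" for w :: "'n::finite control"
proof -
  obtain v0 v where w: "w = (v0, v)" by (cases w)
  have "v0 \<ge> 0" "v0 - (norm v)\<^sup>2 > 0" using that by (auto simp: w control_set_def)
  moreover from this have "v0 * (v0 - (norm v)\<^sup>2) \<le> v0 * v0" by (intro mult_left_mono) auto
  ultimately show ?thesis by (simp add: w mu_star_def pos_le_divide_eq power2_eq_square)
qed

theorem mainTheorem14:
  fixes A :: "real^'n^'m" and b :: "real^'m" and c :: "real^'n"
    and r \<epsilon> :: real and \<eta> \<alpha> :: "nat \<Rightarrow> real" and N :: nat
    and z :: "nat \<Rightarrow> ('n, 'm) primal_dual \<times> 'n control"
  assumes "rank A = CARD('m)"
    and "strictly_feasible A b c \<noteq> {}"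
    and "0 < r" and "r < 1"
    and "\<And>k. 0 \<le> \<eta> k"
    and "PTFM2_run A b c r \<epsilon> \<eta> N z \<alpha>"
  shows "(\<forall>w \<in> (control_set :: 'n control set). fst w \<le> mu_star w) \<and>
    (\<forall>k<N. delta_measure (z k) \<le> beta_param r \<longrightarrow>
       mu_star (snd (z (Suc k))) \<le> 1 / (1 + gamma2 CARD('n) r) * mu_star (snd (z k)))"
proof (intro conjI ballI allI impI)
  fix w :: "'n control"
  assume "w \<in> control_set"
  thus "fst w \<le> mu_star w" by (rule fst_le_mu_star)
next
  fix k
  assume k: "k < N" and \<delta>: "delta_measure (z k) \<le> beta_param r"
  have "predictor_step A b c r (z k) (\<alpha> k) (z (Suc k))"
    using assms(6) k \<delta> by (simp add: PTFM2_run_def)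
  with PTFM2_run_interior[OF assms(6)] k \<delta>
  show "mu_star (snd (z (Suc k))) \<le> 1 / (1 + gamma2 CARD('n) r) * mu_star (snd (z k))"
    by (intro predictor_step_mu_star_le[OF assms(1) _ assms(3,4)]) auto
qed

end
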